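(* Let $k$ be an infinite field of arbitrary characteristic and $S = k[x_0,\ldots,x_n]$. Let $X$ be an arrangement of $d \ge 1$ linear spaces in $\mathbb{P}^n$ over $k$, and let $I_1,\ldots,I_d \subseteq S$ be the homogeneous ideals of these linear spaces (each $I_i$ is generated by linear forms). Then the ideal $I(X) = I_1 \cap \cdots \cap I_d$ of $X$ is $d$-regular.
   Context: $S = k[x_0,\ldots,x_n]$ has its standard grading. Regularity is in the sense of Castelnuovo and Mumford: let $M$ be a finitely generated graded $S$-module with minimal graded free resolution $\cdots \to F_1 \to F_0 \to M \to 0$, where $F_i = \bigoplus_{\alpha} S(-e_{\alpha,i})$. Then $M$ is $r$-regular if $e_{\alpha,i} \le r+i$ for all $\alpha$ and $i$ (the zero module is $r$-regular for every $r$). An ideal is called $r$-regular if it is $r$-regular as a graded $S$-module. *)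

theory Defs
  imports Complex_Main "HOL-Library.Poly_Mapping" "HOL-Library.Function_Algebras" "HOL-Algebra.Ideal" "HOL-Algebra.Module"
begin

text \<open>
  A polynomial is a finitely supported map from monomials to coefficients, a monomial a finitely
  supported map from variable indices to exponents; multiplication is the convolution product of
  \<^theory>\<open>HOL-Library.Poly_Mapping\<close>. The index type is all of \<^typ>\<open>nat\<close>, and the ring
  \<open>S = k[x\<^sub>0,\<dots>,x\<^sub>n]\<close> is cut out as a carrier set, so that \<open>n\<close> is an ordinary natural number.
\<close>

type_synonym 'k mpoly = "(nat \<Rightarrow>\<^sub>0 nat) \<Rightarrow>\<^sub>0 'k"

definition polyring :: "nat \<Rightarrow> 'k::field mpoly ring" where
  "polyring n = \<lparr>carrier = {p. \<forall>m\<in>Poly_Mapping.keys p. Poly_Mapping.keys m \<subseteq> {..n}},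
     monoid.mult = (*), monoid.one = 1, ring.zero = 0, ring.add = (+)\<rparr>"

definition monom_deg :: "(nat \<Rightarrow>\<^sub>0 nat) \<Rightarrow> nat" where
  "monom_deg m = (\<Sum>i\<in>Poly_Mapping.keys m. Poly_Mapping.lookup m i)"

text \<open>The graded piece \<open>S\<^sub>j\<close>, for every integer \<open>j\<close>; it contains \<open>0\<close>, and is zero for \<open>j < 0\<close>.\<close>

definition homog :: "nat \<Rightarrow> int \<Rightarrow> 'k::field mpoly set" where
  "homog n j = {p \<in> carrier (polyring n). \<forall>m\<in>Poly_Mapping.keys p. int (monom_deg m) = j}"

text \<open>The ideal \<open>(x\<^sub>0,\<dots>,x\<^sub>n)\<close>: polynomials whose coefficient at the monomial \<open>1\<close> vanishes.\<close>

definition irrelevant_ideal :: "nat \<Rightarrow> 'k::field mpoly set" where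
  "irrelevant_ideal n = {p \<in> carrier (polyring n). Poly_Mapping.lookup p 0 = 0}"


section \<open>Graded modules and Castelnuovo--Mumford regularity\<close>

text \<open>
  A grading of an \<open>S\<close>-module \<open>M\<close> is a family \<open>G\<close> of additive subgroups indexed by the integers
  such that \<open>M\<close> is their internal direct sum and \<open>S\<^sub>i \<cdot> G\<^sub>j \<subseteq> G\<^sub>i\<^sub>+\<^sub>j\<close>.
\<close>

definition graded_module ::
  "nat \<Rightarrow> ('k::field mpoly, 'm) module \<Rightarrow> (int \<Rightarrow> 'm set) \<Rightarrow> bool" where
  "graded_module n M G \<longleftrightarrow>
     Module.module (polyring n) M \<and>
     (\<forall>j. additive_subgroup (G j) M) \<and>
     (\<forall>i j. \<forall>a\<in>homog n i. \<forall>x\<in>G j. a \<odot>\<^bsub>M\<^esub> x \<in> G (i + j)) \<and>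
     (\<forall>x\<in>carrier M. \<exists>!c. (\<forall>j. c j \<in> G j) \<and> finite {j. c j \<noteq> \<zero>\<^bsub>M\<^esub>} \<and>
        x = (\<Oplus>\<^bsub>M\<^esub>j\<in>{j. c j \<noteq> \<zero>\<^bsub>M\<^esub>}. c j))"

text \<open>\<open>S\<close>-linear maps of degree \<open>0\<close>.\<close>

definition graded_hom ::
  "nat \<Rightarrow> ('k::field mpoly, 'a) module \<Rightarrow> (int \<Rightarrow> 'a set) \<Rightarrow>
     ('k mpoly, 'b) module \<Rightarrow> (int \<Rightarrow> 'b set) \<Rightarrow> ('a \<Rightarrow> 'b) \<Rightarrow> bool" where
  "graded_hom n M G N H f \<longleftrightarrow>
     f \<in> carrier M \<rightarrow> carrier N \<and>
     (\<forall>x\<in>carrier M. \<forall>y\<in>carrier M. f (x \<oplus>\<^bsub>M\<^esub> y) = f x \<oplus>\<^bsub>N\<^esub> f y) \<and>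
     (\<forall>a\<in>carrier (polyring n). \<forall>x\<in>carrier M. f (a \<odot>\<^bsub>M\<^esub> x) = a \<odot>\<^bsub>N\<^esub> f x) \<and>
     (\<forall>j. f ` G j \<subseteq> H j)"

text \<open>
  The free module of rank \<open>b\<close>: coordinates are indexed by \<open>\<alpha> < b\<close>, and a vector is a function on
  \<^typ>\<open>nat\<close> that is \<open>0\<close> from index \<open>b\<close> on. The record fields \<open>mult\<close> and \<open>one\<close> are required by the type
  of modules but play no role there. With \<open>e\<close> the list of twists, \<open>free_grading n b e\<close> is the
  grading of the direct sum of the \<open>S(-e\<^sub>\<alpha>)\<close> over \<open>\<alpha> < b\<close>, where \<open>S(-e)\<^sub>j = S\<^sub>j\<^sub>-\<^sub>e\<close>.
\<close>

definition free_module :: "nat \<Rightarrow> nat \<Rightarrow> ('k::field mpoly, nat \<Rightarrow> 'k mpoly) module" where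
  "free_module n b = \<lparr>
     carrier = {v. (\<forall>\<alpha><b. v \<alpha> \<in> carrier (polyring n)) \<and> (\<forall>\<alpha>\<ge>b. v \<alpha> = 0)},
     monoid.mult = (\<lambda>u v \<alpha>. u \<alpha> * v \<alpha>), monoid.one = (\<lambda>\<alpha>. if \<alpha> < b then 1 else 0),
     ring.zero = (\<lambda>_. 0), ring.add = (\<lambda>u v \<alpha>. u \<alpha> + v \<alpha>),
     smult = (\<lambda>p v \<alpha>. p * v \<alpha>)\<rparr>"

definition free_grading :: "nat \<Rightarrow> nat \<Rightarrow> (nat \<Rightarrow> int) \<Rightarrow> int \<Rightarrow> (nat \<Rightarrow> 'k::field mpoly) set" where
  "free_grading n b e j = {v \<in> carrier (free_module n b). \<forall>\<alpha><b. v \<alpha> \<in> homog n (j - e \<alpha>)}"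

text \<open>
  The complex \<open>\<cdots> \<rightarrow> F\<^sub>2 \<rightarrow> F\<^sub>1 \<rightarrow> F\<^sub>0 \<rightarrow> M \<rightarrow> 0\<close> with \<open>F\<^sub>i\<close> the direct sum of the \<open>S(-e i \<alpha>)\<close> over
  \<open>\<alpha> < b i\<close>, augmentation \<open>\<epsilon>: F\<^sub>0 \<rightarrow> M\<close> and differentials \<open>d i: F\<^sub>i\<^sub>+\<^sub>1 \<rightarrow> F\<^sub>i\<close>, is exact, and minimal:
  the image of \<open>d i\<close> lies in \<open>(x\<^sub>0,\<dots>,x\<^sub>n) F\<^sub>i\<close>, i.e. all its coordinates lie in the irrelevant ideal.
  All ranks are finite, so a module with such a resolution is finitely generated.
\<close>

definition minimal_graded_free_resolution ::
  "nat \<Rightarrow> ('k::field mpoly, 'm) module \<Rightarrow> (int \<Rightarrow> 'm set) \<Rightarrow> (nat \<Rightarrow> nat) \<Rightarrow> (nat \<Rightarrow> nat \<Rightarrow> int) \<Rightarrow>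
     ((nat \<Rightarrow> 'k mpoly) \<Rightarrow> 'm) \<Rightarrow> (nat \<Rightarrow> (nat \<Rightarrow> 'k mpoly) \<Rightarrow> (nat \<Rightarrow> 'k mpoly)) \<Rightarrow> bool" where
  "minimal_graded_free_resolution n M G b e \<epsilon> d \<longleftrightarrow>
     (let F = (\<lambda>i. free_module n (b i)); FG = (\<lambda>i. free_grading n (b i) (e i)) in
       graded_hom n (F 0) (FG 0) M G \<epsilon> \<and>
       (\<forall>i. graded_hom n (F (Suc i)) (FG (Suc i)) (F i) (FG i) (d i)) \<and>
       \<epsilon> ` carrier (F 0) = carrier M \<and>
       d 0 ` carrier (F 1) = {v \<in> carrier (F 0). \<epsilon> v = \<zero>\<^bsub>M\<^esub>} \<and>
       (\<forall>i. d (Suc i) ` carrier (F (Suc (Suc i))) =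
          {v \<in> carrier (F (Suc i)). d i v = \<zero>\<^bsub>F i\<^esub>}) \<and>
       (\<forall>i. \<forall>v\<in>carrier (F (Suc i)). \<forall>\<alpha><b i. d i v \<alpha> \<in> irrelevant_ideal n))"

text \<open>
  Minimal graded free resolutions are unique up to isomorphism, so the twists do not depend on the
  resolution; existence of a resolution is part of the assertion that \<open>M\<close> is \<open>r\<close>-regular.
\<close>

definition regular_module ::
  "nat \<Rightarrow> int \<Rightarrow> ('k::field mpoly, 'm) module \<Rightarrow> (int \<Rightarrow> 'm set) \<Rightarrow> bool" where
  "regular_module n r M G \<longleftrightarrow>
     graded_module n M G \<and>
     (\<exists>b e \<epsilon> d. minimal_graded_free_resolution n M G b e \<epsilon> d \<and>
        (\<forall>i. \<forall>\<alpha><b i. e i \<alpha> \<le> r + int i))"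

definition ideal_module :: "nat \<Rightarrow> 'k::field mpoly set \<Rightarrow> ('k mpoly, 'k mpoly) module" where
  "ideal_module n I =
     \<lparr>carrier = I, monoid.mult = (*), monoid.one = 1, ring.zero = 0, ring.add = (+), smult = (*)\<rparr>"

definition regular_ideal :: "nat \<Rightarrow> int \<Rightarrow> 'k::field mpoly set \<Rightarrow> bool" where
  "regular_ideal n r I \<longleftrightarrow>
     ideal I (polyring n) \<and> regular_module n r (ideal_module n I) (\<lambda>j. I \<inter> homog n j)"


section \<open>Linear spaces and their ideals\<close>

text \<open>
  A linear space in projective \<open>n\<close>-space is given by its affine cone, a vector subspace of
  \<open>k\<^sup>n\<^sup>+\<^sup>1\<close>; points of \<open>k\<^sup>n\<^sup>+\<^sup>1\<close> are functions on \<^typ>\<open>nat\<close> that are \<open>0\<close> beyond index \<open>n\<close>. The cone \<open>{0}\<close>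
  stands for the empty linear space, with ideal \<open>(x\<^sub>0,\<dots>,x\<^sub>n)\<close>. Since \<open>Module.thy\<close> of HOL-Algebra
  also has a locale called module, the vector space notion is written with its qualified name.
\<close>

lemma module_pointwise_scale: "Modules.module (\<lambda>c (v :: nat \<Rightarrow> 'k::field) i. c * v i)"
  by unfold_locales (auto simp: plus_fun_def algebra_simps)

definition linear_space :: "nat \<Rightarrow> (nat \<Rightarrow> 'k::field) set \<Rightarrow> bool" where
  "linear_space n V \<longleftrightarrow>
     V \<subseteq> {v. \<forall>i>n. v i = 0} \<and> Modules.module.subspace (\<lambda>c v i. c * v i) V"

definition eval_poly :: "(nat \<Rightarrow> 'k::field) \<Rightarrow> 'k mpoly \<Rightarrow> 'k" where
  "eval_poly v p = (\<Sum>m\<in>Poly_Mapping.keys p.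
     Poly_Mapping.lookup p m * (\<Prod>i\<in>Poly_Mapping.keys m. v i ^ Poly_Mapping.lookup m i))"

text \<open>Over an infinite field, a polynomial vanishes on a cone iff its homogeneous components do,
  so this is the homogeneous ideal of the linear space with cone \<open>V\<close>.\<close>

definition vanishing_ideal :: "nat \<Rightarrow> (nat \<Rightarrow> 'k::field) set \<Rightarrow> 'k mpoly set" where
  "vanishing_ideal n V = {p \<in> carrier (polyring n). \<forall>v\<in>V. eval_poly v p = 0}"

end

theory Submission
  imports Defs "HOL-Computational_Algebra.Polynomial"
begin

text \<open>
  Let \<open>y\<^sub>0,\<dots>,y\<^sub>n\<close> be generic linear forms and write \<open>Y\<^sub>i = (y\<^sub>0,\<dots>,y\<^sub>i\<^sub>-\<^sub>1)\<close>. A graded module \<open>M\<close> behaves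
  as an \<open>r\<close>-regular one as soon as, in all degrees \<open>j > r\<close>, multiplication by \<open>y\<^sub>i\<close> is injective on
  \<open>M/Y\<^sub>iM\<close> for each \<open>i\<close> and \<open>M/Y\<^sub>n\<^sub>+\<^sub>1M\<close> vanishes. If \<open>F \<rightarrow> M\<close> is onto with \<open>F\<close> free on generators of degree at
  most \<open>r\<close>, then the kernel \<open>N\<close> has the same property for \<open>r + 1\<close>, because \<open>N\<^sub>j \<inter> Y\<^sub>iF = (Y\<^sub>iN)\<^sub>j\<close> for
  \<open>j > r + 1\<close>. In particular \<open>N\<close> is generated in degrees at most \<open>r + 1\<close>, hence finitely generated, and
  iterating with minimal sets of generators gives a minimal resolution with the required twists.

  It remains to show the property with \<open>r = d - 1\<close> for \<open>M = S/I\<close>, \<open>I = I\<^sub>1 \<inter> \<dots> \<inter> I\<^sub>d\<close>, by induction on \<open>d\<close>.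
  Suppose \<open>y\<^sub>i u \<in> I + Y\<^sub>i\<close>. If the intersection \<open>W\<close> of the cones meets \<open>y\<^sub>0 = \<dots> = y\<^sub>i\<^sub>-\<^sub>1 = 0\<close> outside \<open>0\<close>, then projecting
  along \<open>W\<close> shows that \<open>I + Y\<^sub>i\<close> is the ideal of a union of linear spaces on none of which \<open>y\<^sub>i\<close>
  vanishes. Otherwise the linear forms in the \<open>I\<^sub>a\<close> and in \<open>Y\<^sub>i\<close> span \<open>S\<^sub>1\<close>. With \<open>J\<^sub>a\<close> the intersection of the
  remaining ideals, induction gives \<open>w \<in> J\<^sub>a + Y\<^sub>i\<close> whenever \<open>y\<^sub>i\<^sup>2 w \<in> I + Y\<^sub>i\<close> and \<open>deg w \<ge> d - 1\<close>; since
  \<open>x J\<^sub>a \<subseteq> I\<close> for linear \<open>x \<in> I\<^sub>a\<close>, all of \<open>S\<^sub>1 w\<close> lies in \<open>I + Y\<^sub>i\<close>. Descending induction on \<open>i\<close>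
  finishes the argument.
\<close>

subsection \<open>Polynomials and their graded pieces\<close>

abbreviation "lookup \<equiv> Poly_Mapping.lookup"
abbreviation "keys \<equiv> Poly_Mapping.keys"
abbreviation "single \<equiv> Poly_Mapping.single"

lemma polyring_carrier_iff: "p \<in> carrier (polyring n) \<longleftrightarrow> (\<forall>m\<in>keys p. keys m \<subseteq> {..n})"
  by (simp add: polyring_def)

lemma homog_iff: "p \<in> homog n j \<longleftrightarrow> (\<forall>m\<in>keys p. keys m \<subseteq> {..n} \<and> int (monom_deg m) = j)"
  by (auto simp: homog_def polyring_carrier_iff)

lemma homog_carrier: "p \<in> homog n j \<Longrightarrow> p \<in> carrier (polyring n)"
  by (simp add: homog_def)

lemma keys_exponent_add: "keys (a + b :: nat \<Rightarrow>\<^sub>0 nat) = keys a \<union> keys b"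
  by (auto simp: in_keys_iff lookup_add)

lemma monom_deg_superset: "finite A \<Longrightarrow> keys m \<subseteq> A \<Longrightarrow> monom_deg m = (\<Sum>i\<in>A. lookup m i)"
  unfolding monom_deg_def by (rule sum.mono_neutral_left) (auto simp: in_keys_iff)

lemma monom_deg_0 [simp]: "monom_deg 0 = 0"
  by (simp add: monom_deg_def)

lemma monom_deg_single [simp]: "monom_deg (single i k) = k"
  by (simp add: monom_deg_def)

lemma monom_deg_add: "monom_deg (a + b) = monom_deg a + monom_deg b"
  by (simp add: monom_deg_superset[of "keys a \<union> keys b" a] monom_deg_superset[of "keys a \<union> keys b" b]
      monom_deg_superset[of "keys a \<union> keys b" "a + b"] keys_exponent_add lookup_add sum.distrib)

lemma monom_deg_eq_0_iff: "monom_deg m = 0 \<longleftrightarrow> m = 0"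
  by (auto simp: monom_deg_def in_keys_iff intro!: poly_mapping_eqI)

lemma poly_carrier_0 [simp]: "0 \<in> carrier (polyring n)"
  by (simp add: polyring_carrier_iff)

lemma poly_carrier_add: "p \<in> carrier (polyring n) \<Longrightarrow> q \<in> carrier (polyring n) \<Longrightarrow> p + q \<in> carrier (polyring n)"
  using keys_add[of p q] by (fastforce simp: polyring_carrier_iff)

lemma poly_carrier_mult: "p \<in> carrier (polyring n) \<Longrightarrow> q \<in> carrier (polyring n) \<Longrightarrow> p * q \<in> carrier (polyring n)"
  using keys_mult[of p q] by (fastforce simp: polyring_carrier_iff keys_exponent_add)

lemma keys_uminus: "keys (- p) = keys (p :: 'a \<Rightarrow>\<^sub>0 'b::ab_group_add)"
  by (auto simp: in_keys_iff)

lemma poly_carrier_uminus: "p \<in> carrier (polyring n) \<Longrightarrow> - p \<in> carrier (polyring n)"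
  by (simp add: polyring_carrier_iff keys_uminus)

lemma homog_0 [simp]: "0 \<in> homog n j"
  by (simp add: homog_iff)

lemma homog_add: "p \<in> homog n j \<Longrightarrow> q \<in> homog n j \<Longrightarrow> p + q \<in> homog n j"
  using keys_add[of p q] by (fastforce simp: homog_iff)

lemma homog_uminus: "p \<in> homog n j \<Longrightarrow> - p \<in> homog n j"
  by (simp add: homog_iff keys_uminus)

lemma homog_diff: "p \<in> homog n j \<Longrightarrow> q \<in> homog n j \<Longrightarrow> p - q \<in> homog n j"
  by (metis homog_add homog_uminus diff_conv_add_uminus)

lemma homog_sum: "(\<And>x. x \<in> A \<Longrightarrow> f x \<in> homog n j) \<Longrightarrow> sum f A \<in> homog n j"
  by (induction A rule: infinite_finite_induct) (auto intro: homog_add)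

lemma homog_mult: "p \<in> homog n i \<Longrightarrow> q \<in> homog n j \<Longrightarrow> p * q \<in> homog n (i + j)"
  using keys_mult[of p q] by (fastforce simp: homog_iff keys_exponent_add monom_deg_add)

lemma homog_mult': "p \<in> homog n i \<Longrightarrow> q \<in> homog n j \<Longrightarrow> k = i + j \<Longrightarrow> p * q \<in> homog n k"
  using homog_mult by blast

lemma homog_neg: "p \<in> homog n j \<Longrightarrow> j < 0 \<Longrightarrow> p = 0"
  by (rule ccontr) (auto simp: homog_iff in_keys_iff poly_mapping_eq_iff fun_eq_iff)

lemma homog_single: "keys m \<subseteq> {..n} \<Longrightarrow> int (monom_deg m) = j \<Longrightarrow> single m c \<in> homog n j"
  by (simp add: homog_iff)

lemma homog_const: "single 0 c \<in> homog n 0"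
  by (simp add: homog_iff)

lemma homog_0_const: "p \<in> homog n 0 \<Longrightarrow> p = single 0 (lookup p 0)"
  by (rule poly_mapping_eqI)
     (auto simp: homog_iff lookup_single when_def monom_deg_eq_0_iff in_keys_iff)

lemma poly_sum_singles: "p = (\<Sum>m\<in>keys p. single m (lookup p m))"
  by (rule poly_mapping_eqI)
     (auto simp: lookup_sum lookup_single when_def sum.delta in_keys_iff)

text \<open>Runs over partial sums of the terms of \<open>p\<close>. These stay homogeneous of
  degree \<open>j\<close>, so the \<open>add\<close> case may assume homogeneity of both
  summands.\<close>

lemma homog_induct [consumes 1, case_names zero add mono]:
  assumes "p \<in> homog n j" "P 0"
    and "\<And>p q. p \<in> homog n j \<Longrightarrow> q \<in> homog n j \<Longrightarrow> P p \<Longrightarrow> P q \<Longrightarrow> P (p + q)"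
    and "\<And>m c. keys m \<subseteq> {..n} \<Longrightarrow> int (monom_deg m) = j \<Longrightarrow> P (single m c)"
  shows "P p"
proof -
  have "finite A \<Longrightarrow> A \<subseteq> keys p \<Longrightarrow>
      (\<Sum>m\<in>A. single m (lookup p m)) \<in> homog n j \<and> P (\<Sum>m\<in>A. single m (lookup p m))" for A
  proof (induction A rule: finite_induct)
    case (insert x A)
    have "keys x \<subseteq> {..n}" "int (monom_deg x) = j"
      using insert.prems assms(1) by (auto simp: homog_iff)
    then have "single x (lookup p x) \<in> homog n j" "P (single x (lookup p x))"
      using assms(4) by (auto intro: homog_single)
    then show ?case using insert by (auto intro!: assms(3) homog_add)
  qed (simp add: assms(2))
  from this[of "keys p"] show ?thesis
    using poly_sum_singles[of p] by simp
qed

lemma monomial_split: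
  assumes "m \<noteq> (0 :: nat \<Rightarrow>\<^sub>0 nat)"
  obtains i m' where "i \<in> keys m" "m = single i 1 + m'"
proof -
  obtain i where i: "i \<in> keys m"
    using assms by (metis in_keys_iff lookup_zero poly_mapping_eqI)
  have "m = single i 1 + (m - single i 1)"
    using i by (intro poly_mapping_eqI) (auto simp: lookup_add lookup_minus lookup_single when_def in_keys_iff)
  with i that show ?thesis by blast
qed

subsection \<open>Evaluation\<close>

definition monom_val :: "(nat \<Rightarrow> 'k::field) \<Rightarrow> (nat \<Rightarrow>\<^sub>0 nat) \<Rightarrow> 'k" where
  "monom_val v m = (\<Prod>i\<in>keys m. v i ^ lookup m i)"

lemma monom_val_superset: "finite A \<Longrightarrow> keys m \<subseteq> A \<Longrightarrow> monom_val v m = (\<Prod>i\<in>A. v i ^ lookup m i)"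
  unfolding monom_val_def by (rule prod.mono_neutral_left) (auto simp: in_keys_iff)

lemma monom_val_add: "monom_val v (a + b) = monom_val v a * monom_val v b"
  by (simp add: monom_val_superset[of "keys a \<union> keys b" a] monom_val_superset[of "keys a \<union> keys b" b]
      monom_val_superset[of "keys a \<union> keys b" "a + b"] keys_exponent_add lookup_add power_add prod.distrib)

lemma eval_poly_alt: "eval_poly v p = (\<Sum>m\<in>keys p. lookup p m * monom_val v m)"
  by (simp add: eval_poly_def monom_val_def)

lemma eval_0 [simp]: "eval_poly v 0 = 0"
  by (simp add: eval_poly_def)

lemma eval_single [simp]: "eval_poly v (single m c) = c * monom_val v m"
  by (simp add: eval_poly_alt)

lemma eval_add: "eval_poly v (p + q) = eval_poly v p + eval_poly v q"
  unfolding eval_poly_alt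
  by (rule setsum_keys_plus_distrib) (auto simp: algebra_simps)

lemma eval_uminus: "eval_poly v (- p) = - eval_poly v p"
  by (simp add: eval_poly_alt keys_uminus sum_negf)

lemma eval_diff: "eval_poly v (p - q) = eval_poly v p - eval_poly v q"
  using eval_add[of v p "- q"] by (simp add: eval_uminus)

lemma eval_sum: "eval_poly v (sum f A) = (\<Sum>x\<in>A. eval_poly v (f x))"
  by (induction A rule: infinite_finite_induct) (auto simp: eval_add)

lemma eval_mult: "eval_poly v (p * q) = eval_poly v p * eval_poly v q"
proof -
  have "p * q = (\<Sum>a\<in>keys p. \<Sum>b\<in>keys q. single (a + b) (lookup p a * lookup q b))"
    by (subst poly_sum_singles[of p], subst poly_sum_singles[of q])
       (simp add: sum_product mult_single)
  then have "eval_poly v (p * q) =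
      (\<Sum>a\<in>keys p. \<Sum>b\<in>keys q. (lookup p a * monom_val v a) * (lookup q b * monom_val v b))"
    by (simp add: eval_sum monom_val_add algebra_simps)
  then show ?thesis
    by (simp add: eval_poly_alt sum_product)
qed

text \<open>Substituting \<open>v i + t * w i\<close> for each variable gives a polynomial in
  \<open>t\<close>. Identities along a line can then be settled by counting roots over the infinite
  field.\<close>

lemma eval_on_line: "\<exists>P. \<forall>t. eval_poly (\<lambda>i. v i + t * w i) p = poly P t"
  by (rule exI[of _ "\<Sum>m\<in>keys p. [:lookup p m:] * (\<Prod>i\<in>keys m. [:v i, w i:] ^ lookup m i)"])
     (simp add: eval_poly_def poly_sum poly_prod)

lemma eval_homog_scale:
  assumes "p \<in> homog n j"
  shows "eval_poly (\<lambda>i. t * v i) p = t ^ nat j * eval_poly v p"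
proof -
  have "monom_val (\<lambda>i. t * v i) m = t ^ nat j * monom_val v m" if "m \<in> keys p" for m
  proof -
    have "nat j = monom_deg m" using assms that by (auto simp: homog_iff)
    then show ?thesis
      by (simp add: monom_val_def power_mult_distrib prod.distrib monom_deg_def power_sum)
  qed
  then show ?thesis
    by (simp add: eval_poly_alt sum_distrib_left algebra_simps)
qed

subsection \<open>Linear forms\<close>

definition lin :: "nat \<Rightarrow> (nat \<Rightarrow> 'k::field) \<Rightarrow> 'k mpoly" where
  "lin n c = (\<Sum>i\<le>n. single (single i 1) (c i))"

lemma lin_homog: "lin n c \<in> homog n 1"
  unfolding lin_def by (intro homog_sum homog_single) auto

lemma eval_lin: "eval_poly v (lin n c) = (\<Sum>i\<le>n. c i * v i)"
  by (simp add: lin_def eval_sum monom_val_def)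

lemma lin_add: "lin n (\<lambda>i. c i + c' i) = lin n c + lin n c'"
  by (simp add: lin_def single_add sum.distrib)

lemma lin_scale: "lin n (\<lambda>i. a * c i) = single 0 a * lin n c"
  by (simp add: lin_def mult_single sum_distrib_left)

text \<open>Substitute \<open>x\<^sub>i - v\<^sub>i y\<close> for \<open>x\<^sub>i\<close>; when \<open>y(v) = 1\<close> this is the projection along \<open>v\<close> onto the
  hyperplane \<open>y = 0\<close>.\<close>

lemma projection_homog:
  assumes "p \<in> homog n j"
  shows "\<exists>p'\<in>homog n j. \<exists>g\<in>homog n (j - 1). p = p' + lin n c * g \<and>
    (\<forall>z. eval_poly z p' = eval_poly (\<lambda>i. z i - eval_poly z (lin n c) * v i) p)"
    (is "?Q j p")
proof -
  \<comment> \<open>\<open>?Q\<close> is multiplicative, since (p' + yg)(q' + yh) = p'q' + y(gq' +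
    p'h + ygh), and it is additive. Hence only constants and variables have to be checked.\<close>
  have mult: "?Q (i + k) (p * q)" if "?Q i p" "?Q k q" for i k p q
  proof -
    from that obtain p' g q' h where *:
      "p' \<in> homog n i" "g \<in> homog n (i - 1)" "q' \<in> homog n k" "h \<in> homog n (k - 1)"
      "p = p' + lin n c * g" "q = q' + lin n c * h"
      "\<forall>z. eval_poly z p' = eval_poly (\<lambda>i. z i - eval_poly z (lin n c) * v i) p"
      "\<forall>z. eval_poly z q' = eval_poly (\<lambda>i. z i - eval_poly z (lin n c) * v i) q"
      by blast
    have "p' * q' \<in> homog n (i + k)" using * by (intro homog_mult)
    moreover have "g * q' + p' * h + lin n c * (g * h) \<in> homog n (i + k - 1)"
      using * by (intro homog_add homog_mult'[OF _ homog_mult[of g]] homog_mult'[of g] homog_mult'[of p'] lin_homog) (auto simp: lin_homog)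
    moreover have "p * q = p' * q' + lin n c * (g * q' + p' * h + lin n c * (g * h))"
      unfolding *(5,6) by (simp add: algebra_simps)
    moreover have "\<forall>z. eval_poly z (p' * q') = eval_poly (\<lambda>i. z i - eval_poly z (lin n c) * v i) (p * q)"
      using *(7,8) by (simp add: eval_mult)
    ultimately show ?thesis by blast
  qed
  have const: "?Q 0 (single 0 a)" for a
    by (rule bexI[OF _ homog_const], rule bexI[of _ 0]) (auto simp: monom_val_def)
  \<comment> \<open>The split is x_i = (x_i - v_i y) + y v_i, where y is
    \<open>lin n c\<close>.\<close>
  have var: "?Q 1 (single (single i 1) 1)" if "i \<le> n" for i
  proof (rule bexI, rule bexI, intro conjI)
    show "single (single i 1) 1 = (single (single i 1) 1 - single 0 (v i) * lin n c) + lin n c * single 0 (v i)"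
      by (simp add: algebra_simps)
    show "single 0 (v i) \<in> homog n (1 - 1)" using homog_const by simp
    show "single (single i 1) 1 - single 0 (v i) * lin n c \<in> homog n 1"
      using that by (intro homog_diff homog_mult'[OF homog_const lin_homog] homog_single) auto
    show "\<forall>z. eval_poly z (single (single i 1) 1 - single 0 (v i) * lin n c) =
        eval_poly (\<lambda>i. z i - eval_poly z (lin n c) * v i) (single (single i 1) 1)"
      by (simp add: eval_diff eval_mult) (simp add: monom_val_def)
  qed
  have monomial: "?Q (int (monom_deg m)) (single m a)" if "keys m \<subseteq> {..n}" for m a
    using that
  proof (induction "monom_deg m" arbitrary: m)
    case 0
    then show ?case using const by (simp add: monom_deg_eq_0_iff)
  next
    case (Suc d)
    then have "m \<noteq> 0" by auto
    then obtain i m' where m: "i \<in> keys m" "m = single i 1 + m'" by (rule monomial_split)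
    then have "?Q (int (monom_deg m')) (single m' a)"
      using Suc by (intro Suc.hyps) (auto simp: monom_deg_add keys_exponent_add)
    moreover have "i \<le> n" using m Suc.prems by auto
    moreover have "single m a = single (single i 1) 1 * single m' a"
      using m by (simp add: mult_single)
    ultimately show ?case
      using mult[OF var] m by (simp add: monom_deg_add)
  qed
  show ?thesis using assms
  proof (induction rule: homog_induct)
    case zero
    then show ?case by (rule_tac bexI[of _ 0], rule_tac bexI[of _ 0]) auto
  next
    case (add p q)
    from add(3,4) obtain p' g q' h where *:
      "p' \<in> homog n j" "g \<in> homog n (j - 1)" "q' \<in> homog n j" "h \<in> homog n (j - 1)"
      "p = p' + lin n c * g" "q = q' + lin n c * h"
      "\<forall>z. eval_poly z p' = eval_poly (\<lambda>i. z i - eval_poly z (lin n c) * v i) p"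
      "\<forall>z. eval_poly z q' = eval_poly (\<lambda>i. z i - eval_poly z (lin n c) * v i) q"
      by blast
    have "p + q = (p' + q') + lin n c * (g + h)"
      unfolding *(5,6) by (simp add: algebra_simps)
    moreover have "p' + q' \<in> homog n j" "g + h \<in> homog n (j - 1)" using * by (auto intro: homog_add)
    moreover have "\<forall>z. eval_poly z (p' + q') = eval_poly (\<lambda>i. z i - eval_poly z (lin n c) * v i) (p + q)"
      using *(7,8) by (simp add: eval_add)
    ultimately show ?case by blast
  next
    case (mono m c)
    with monomial[of m c] show ?case by auto
  qed
qed

section \<open>Duality between coordinate subspaces and linear forms\<close>

interpretation fv: vector_space "\<lambda>c (v :: nat \<Rightarrow> 'k::field) i. c * v i"
  by unfold_locales (auto simp: plus_fun_def algebra_simps)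

definition coord_space :: "nat \<Rightarrow> (nat \<Rightarrow> 'k::field) set" where
  "coord_space n = {v. \<forall>i>n. v i = 0}"

definition dot :: "nat \<Rightarrow> (nat \<Rightarrow> 'k::field) \<Rightarrow> (nat \<Rightarrow> 'k) \<Rightarrow> 'k" where
  "dot n c v = (\<Sum>i\<le>n. c i * v i)"

lemma eval_lin_dot: "eval_poly v (lin n c) = dot n c v"
  by (simp add: eval_lin dot_def)

lemma dot_commute: "dot n c v = dot n v c"
  by (simp add: dot_def mult.commute)

lemma dot_add: "dot n c (\<lambda>i. v i + w i) = dot n c v + dot n c w"
  by (simp add: dot_def algebra_simps sum.distrib)

lemma dot_scale: "dot n c (\<lambda>i. a * v i) = a * dot n c v"
  by (simp add: dot_def sum_distrib_left algebra_simps)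

lemma dot_diff_scale: "dot n c (\<lambda>i. v i - a * w i) = dot n c v - a * dot n c w"
  by (simp add: dot_def algebra_simps sum_subtractf sum_distrib_left)

lemma linear_spaceD:
  assumes "linear_space n V"
  shows "V \<subseteq> coord_space n" "fv.subspace V"
  using assms by (auto simp: linear_space_def coord_space_def)

lemma linear_space_diff_scale:
  assumes "linear_space n V" "v \<in> V" "w \<in> V"
  shows "(\<lambda>i. v i - a * w i) \<in> V"
proof -
  have "v - (\<lambda>i. a * w i) \<in> V"
    using linear_spaceD(2)[OF assms(1)] assms(2,3) by (intro fv.subspace_diff fv.subspace_scale)
  then show ?thesis by (simp add: fun_diff_def)
qed

lemma linear_space_add_scale:
  assumes "linear_space n V" "v \<in> V" "w \<in> V"
  shows "(\<lambda>i. v i + a * w i) \<in> V"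
  using linear_space_diff_scale[OF assms, of "- a"] by simp

lemma linear_space_scale:
  assumes "linear_space n V" "v \<in> V"
  shows "(\<lambda>i. a * v i) \<in> V"
  using fv.subspace_scale[OF linear_spaceD(2)[OF assms(1)] assms(2)] .

lemma subspace_coord_space: "fv.subspace (coord_space n)"
  by (auto simp: fv.subspace_def coord_space_def)

text \<open>Extend a basis of \<open>U\<close> by \<open>x\<close> and take the linear functional
  that is 1 at \<open>x\<close> and 0 on the basis. On \<open>coord_space n\<close> it is the dot
  product with the vector of its values at the unit vectors.\<close>

lemma exists_annihilating_vector:
  fixes x :: "nat \<Rightarrow> 'k::field"
  assumes U: "fv.subspace U" and x: "x \<in> coord_space n" "x \<notin> U" and UE: "U \<subseteq> coord_space n"
  shows "\<exists>v\<in>coord_space n. (\<forall>u\<in>U. dot n u v = 0) \<and> dot n x v \<noteq> 0"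
proof -
  interpret kv: vector_space "(*) :: 'k \<Rightarrow> 'k \<Rightarrow> 'k"
    by unfold_locales (auto simp: algebra_simps)
  interpret pr: vector_space_pair "\<lambda>c (v :: nat \<Rightarrow> 'k) i. c * v i" "(*) :: 'k \<Rightarrow> 'k \<Rightarrow> 'k" ..
  obtain B where B: "B \<subseteq> U" "fv.independent B" "U \<subseteq> fv.span B"
    by (rule fv.maximal_independent_subset)
  have "fv.span B \<subseteq> U" using B U by (simp add: fv.span_minimal)
  then have "x \<notin> fv.span B" using x by auto
  then have "fv.independent (insert x B)"
    using B by (simp add: fv.independent_insert)
  then obtain g where g: "Vector_Spaces.linear (\<lambda>c (v :: nat \<Rightarrow> 'k) i. c * v i) (*) g" "\<forall>b\<in>insert x B. g b = (if b = x then 1 else 0)"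
    using pr.linear_independent_extend[of "insert x B" "\<lambda>b. if b = x then 1 else 0"] by auto
  have gU: "g u = 0" if "u \<in> U" for u
  proof (rule pr.linear_eq_0_on_span[OF g(1)])
    show "u \<in> fv.span B" using that B by auto
    show "g b = 0" if "b \<in> B" for b using that g(2) B x by auto
  qed
  define v where "v = (\<lambda>i. if i \<le> n then g (\<lambda>j. if j = i then 1 else 0) else 0)"
  have gdot: "g u = dot n u v" if u: "u \<in> coord_space n" for u
  proof -
    have "u = (\<Sum>i\<le>n. (\<lambda>j. u i * (if j = i then 1 else 0)))"
    proof
      fix k
      have "(\<Sum>i\<le>n. (\<lambda>j. u i * (if j = i then 1 else 0))) k = (\<Sum>i\<le>n. u i * (if k = i then 1 else 0))"
        by (induction n) auto
      also have "\<dots> = u k" using u by (auto simp: coord_space_def if_distrib sum.delta' cong: if_cong)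
      finally show "u k = (\<Sum>i\<le>n. (\<lambda>j. u i * (if j = i then 1 else 0))) k" by simp
    qed
    then have "g u = g (\<Sum>i\<le>n. (\<lambda>j. u i * (if j = i then 1 else 0)))" by simp
    also have "\<dots> = (\<Sum>i\<le>n. u i * g (\<lambda>j. if j = i then 1 else 0))"
      by (simp only: pr.linear_sum[OF g(1)] pr.linear_scale[OF g(1)])
    also have "\<dots> = dot n u v" by (simp add: dot_def v_def)
    finally show ?thesis .
  qed
  have "v \<in> coord_space n" by (simp add: v_def coord_space_def)
  moreover have "dot n x v \<noteq> 0" using gdot[OF x(1)] g(2) by simp
  moreover have "\<forall>u\<in>U. dot n u v = 0" using gU gdot UE by force
  ultimately show ?thesis by blast
qed

text \<open>The coefficient vectors of the linear forms in the ideal of \<open>V\<close>.\<close>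

definition annihilator :: "nat \<Rightarrow> (nat \<Rightarrow> 'k::field) set \<Rightarrow> (nat \<Rightarrow> 'k) set" where
  "annihilator n V = {c \<in> coord_space n. \<forall>v\<in>V. dot n c v = 0}"

text \<open>Biduality: a form \<open>x\<close> outside the span would be nonzero at some
  \<open>z\<close> killed by the whole span. Such a \<open>z\<close> lies in every
  \<open>V a\<close>, since a subspace is cut out by its annihilator, and so \<open>z = 0\<close> by
  assumption.\<close>

lemma forms_span:
  assumes V: "\<And>a. a \<in> A \<Longrightarrow> linear_space n (V a)" and C: "C \<subseteq> coord_space n"
    and zero: "\<And>z. z \<in> coord_space n \<Longrightarrow> (\<And>a. a \<in> A \<Longrightarrow> z \<in> V a) \<Longrightarrow> (\<And>c. c \<in> C \<Longrightarrow> dot n c z = 0) \<Longrightarrow> z = 0"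
    and x: "x \<in> coord_space n"
  shows "x \<in> fv.span (C \<union> (\<Union>a\<in>A. annihilator n (V a)))"
proof (rule ccontr)
  let ?X = "C \<union> (\<Union>a\<in>A. annihilator n (V a))"
  assume "x \<notin> fv.span ?X"
  moreover have "fv.span ?X \<subseteq> coord_space n"
    using C by (intro fv.span_minimal subspace_coord_space) (auto simp: annihilator_def)
  ultimately obtain z where z: "z \<in> coord_space n" "\<forall>u\<in>fv.span ?X. dot n u z = 0" "dot n x z \<noteq> 0"
    using exists_annihilating_vector[OF fv.subspace_span x] by blast
  have "z \<in> V a" if a: "a \<in> A" for a
  proof (rule ccontr)
    assume "z \<notin> V a"
    then obtain c where c: "c \<in> coord_space n" "\<forall>u\<in>V a. dot n u c = 0" "dot n z c \<noteq> 0"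
      using exists_annihilating_vector[of "V a" z n] linear_spaceD[OF V[OF a]] z by blast
    then have "c \<in> annihilator n (V a)" by (simp add: annihilator_def dot_commute)
    then have "c \<in> fv.span ?X" using a by (intro fv.span_base) auto
    with z c show False by (simp add: dot_commute)
  qed
  moreover have "dot n c z = 0" if "c \<in> C" for c
    using z(2) that by (auto intro: fv.span_base)
  ultimately have "z = 0" using zero z(1) by blast
  with z(3) show False by (simp add: dot_def)
qed

subsection \<open>Generic linear forms\<close>

text \<open>A point of the moment curve. Its dot product with \<open>v\<close> is the value at
  \<open>t\<close> of the polynomial with coefficients \<open>v\<close>, so for a nonzero
  \<open>v\<close> in \<open>coord_space n\<close> it vanishes for at most \<open>n\<close> values
  of \<open>t\<close>.\<close>

definition moment_form :: "nat \<Rightarrow> 'k::field \<Rightarrow> nat \<Rightarrow> 'k" where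
  "moment_form n t = (\<lambda>i. if i \<le> n then t ^ i else 0)"

lemma moment_form_coord: "moment_form n t \<in> coord_space n"
  by (simp add: moment_form_def coord_space_def)

lemma moment_form_poly:
  "dot n (moment_form n t) v = poly (\<Sum>i\<le>n. Polynomial.monom (v i) i) t"
  by (simp add: dot_def moment_form_def poly_sum poly_monom mult.commute)

lemma moment_poly_nonzero:
  fixes v :: "nat \<Rightarrow> 'k::field"
  assumes "v \<in> coord_space n" "v \<noteq> 0"
  shows "(\<Sum>i\<le>n. Polynomial.monom (v i) i) \<noteq> 0" "Polynomial.degree (\<Sum>i\<le>n. Polynomial.monom (v i) i) \<le> n"
proof -
  obtain k where k: "v k \<noteq> 0" using assms(2) by (auto simp: fun_eq_iff)
  then have "k \<le> n" using assms(1) by (auto simp: coord_space_def intro: leI)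
  then have "Polynomial.coeff (\<Sum>i\<le>n. Polynomial.monom (v i) i) k = v k"
    by (simp add: coeff_sum)
  with k show "(\<Sum>i\<le>n. Polynomial.monom (v i) i) \<noteq> 0" by auto
  show "Polynomial.degree (\<Sum>i\<le>n. Polynomial.monom (v i) i) \<le> n"
    by (rule degree_sum_le) (auto intro: order_trans[OF degree_monom_le])
qed

text \<open>A nonzero polynomial of degree at most \<open>n\<close> cannot have the
  \<open>n + 1\<close> distinct roots \<open>t 0\<close>, ..., \<open>t n\<close>.\<close>

lemma moment_forms_independent:
  assumes v: "v \<in> coord_space n" and t: "inj t" "\<And>a. a < Suc n \<Longrightarrow> dot n (moment_form n (t a)) v = 0"
  shows "v = 0"
proof (rule ccontr)
  assume "v \<noteq> 0"
  let ?P = "\<Sum>i\<le>n. Polynomial.monom (v i) i"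
  have P: "?P \<noteq> 0" "Polynomial.degree ?P \<le> n"
    using moment_poly_nonzero[OF v \<open>v \<noteq> 0\<close>] by auto
  have "t ` {..<Suc n} \<subseteq> {x. poly ?P x = 0}" using t(2) by (auto simp: moment_form_poly)
  then have "card (t ` {..<Suc n}) \<le> card {x. poly ?P x = 0}"
    by (intro card_mono poly_roots_finite[OF P(1)])
  also have "\<dots> \<le> n" using card_poly_roots_bound[OF P(1)] P(2) by simp
  finally show False using card_image[of t "{..<Suc n}"] t(1) by (simp add: inj_on_subset)
qed

text \<open>The parameters are chosen one after another. For each \<open>W\<close> that still has a
  nonzero vector killed by the earlier forms, one such vector is fixed; the next parameter has to
  avoid the finitely many roots belonging to these vectors and the earlier parameters.\<close>

lemma generic_moment_forms:
  fixes \<W> :: "(nat \<Rightarrow> 'k::field) set set"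
  assumes inf: "infinite (UNIV :: 'k set)" and fin: "finite \<W>" and E: "\<And>W. W \<in> \<W> \<Longrightarrow> W \<subseteq> coord_space n"
  shows "\<exists>t :: nat \<Rightarrow> 'k. inj t \<and> (\<forall>i. \<forall>W\<in>\<W>. (\<exists>v\<in>W. v \<noteq> 0 \<and> (\<forall>a<i. dot n (moment_form n (t a)) v = 0)) \<longrightarrow>
    (\<exists>v\<in>W. (\<forall>a<i. dot n (moment_form n (t a)) v = 0) \<and> dot n (moment_form n (t i)) v \<noteq> 0))"
proof -
  \<comment> \<open>\<open>P t i r\<close> says that \<open>r\<close> is an admissible value at
    position \<open>i\<close>. It depends on \<open>t\<close> only below \<open>i\<close>, as
    well-founded choice demands.\<close>
  define P where "P = (\<lambda>(t :: nat \<Rightarrow> 'k) (i::nat) r. (\<forall>a<i. t a \<noteq> r) \<and>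
    (\<forall>W\<in>\<W>. (\<exists>v\<in>W. v \<noteq> 0 \<and> (\<forall>a<i. dot n (moment_form n (t a)) v = 0)) \<longrightarrow>
      (\<exists>v\<in>W. (\<forall>a<i. dot n (moment_form n (t a)) v = 0) \<and> dot n (moment_form n r) v \<noteq> 0)))"
  have "\<exists>t. \<forall>i. P t i (t i)"
  proof (rule dependent_wellorder_choice)
    show "P f x r = P g x r" if "\<And>y. y < x \<Longrightarrow> f y = g y" for r f g x
      using that by (simp add: P_def cong: conj_cong)
  next
    fix i :: nat and t :: "nat \<Rightarrow> 'k"
    define Z where "Z = (\<lambda>W :: (nat \<Rightarrow> 'k) set. {v \<in> W. v \<noteq> 0 \<and> (\<forall>a<i. dot n (moment_form n (t a)) v = 0)})"
    define pick where "pick = (\<lambda>W. SOME v. v \<in> Z W)"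
    define bad where "bad = t ` {..<i} \<union>
      (\<Union>W\<in>{W \<in> \<W>. Z W \<noteq> {}}. {r. poly (\<Sum>i\<le>n. Polynomial.monom (pick W i) i) r = 0})"
    have pick: "pick W \<in> Z W" if "Z W \<noteq> {}" for W
      using that unfolding pick_def by (metis someI_ex ex_in_conv)
    have "finite bad"
      unfolding bad_def
    proof (intro finite_UnI finite_UN_I poly_roots_finite)
      fix W assume "W \<in> {W \<in> \<W>. Z W \<noteq> {}}"
      then have "pick W \<in> coord_space n" "pick W \<noteq> 0" using pick[of W] E by (auto simp: Z_def)
      then show "(\<Sum>i\<le>n. Polynomial.monom (pick W i) i) \<noteq> 0" by (rule moment_poly_nonzero)
    qed (use fin in auto)
    then obtain r where r: "r \<notin> bad" using inf ex_new_if_finite by blast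
    have "\<exists>v\<in>W. (\<forall>a<i. dot n (moment_form n (t a)) v = 0) \<and> dot n (moment_form n r) v \<noteq> 0"
      if W: "W \<in> \<W>" and ex: "\<exists>v\<in>W. v \<noteq> 0 \<and> (\<forall>a<i. dot n (moment_form n (t a)) v = 0)" for W
    proof (rule bexI)
      have Z: "Z W \<noteq> {}" using ex by (auto simp: Z_def)
      then have "dot n (moment_form n r) (pick W) \<noteq> 0"
        using r W by (auto simp: bad_def moment_form_poly)
      then show "(\<forall>a<i. dot n (moment_form n (t a)) (pick W) = 0) \<and> dot n (moment_form n r) (pick W) \<noteq> 0"
        using pick[OF Z] by (simp add: Z_def)
      show "pick W \<in> W" using pick[OF Z] by (simp add: Z_def)
    qed
    moreover have "\<forall>a<i. t a \<noteq> r" using r by (auto simp: bad_def)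
    ultimately have "P t i r" unfolding P_def by simp
    then show "\<exists>r. P t i r" ..
  qed
  then obtain t where t: "\<And>i. P t i (t i)" by blast
  have "inj t"
  proof (rule linorder_injI)
    show "t a \<noteq> t b" if "a < b" for a b
      using t[of b] that unfolding P_def by simp
  qed
  moreover have "\<forall>i. \<forall>W\<in>\<W>. (\<exists>v\<in>W. v \<noteq> 0 \<and> (\<forall>a<i. dot n (moment_form n (t a)) v = 0)) \<longrightarrow>
    (\<exists>v\<in>W. (\<forall>a<i. dot n (moment_form n (t a)) v = 0) \<and> dot n (moment_form n (t i)) v \<noteq> 0)"
    using t unfolding P_def by simp
  ultimately show ?thesis by blast
qed

section \<open>Graded pieces of I, Y_i and I + Y_i\<close>

definition vanish :: "nat \<Rightarrow> (nat \<Rightarrow> 'k::field) set \<Rightarrow> int \<Rightarrow> 'k mpoly set" where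
  "vanish n S j = {u \<in> homog n j. \<forall>v\<in>S. eval_poly v u = 0}"

lemma vanish_0 [simp]: "0 \<in> vanish n S j"
  by (simp add: vanish_def)

lemma vanish_add: "p \<in> vanish n S j \<Longrightarrow> q \<in> vanish n S j \<Longrightarrow> p + q \<in> vanish n S j"
  by (simp add: vanish_def homog_add eval_add)

lemma vanish_mult: "q \<in> homog n i \<Longrightarrow> p \<in> vanish n S j \<Longrightarrow> q * p \<in> vanish n S (i + j)"
  by (simp add: vanish_def homog_mult eval_mult)

text \<open>The degree \<open>j\<close> piece of the ideal Y_i.\<close>

definition form_combs :: "nat \<Rightarrow> (nat \<Rightarrow> nat \<Rightarrow> 'k::field) \<Rightarrow> nat \<Rightarrow> int \<Rightarrow> 'k mpoly set" where
  "form_combs n c i j = {\<Sum>a<i. lin n (c a) * g a | g. \<forall>a<i. g a \<in> homog n (j - 1)}"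

lemma form_combs_0 [simp]: "0 \<in> form_combs n c i j"
  unfolding form_combs_def by (auto intro!: exI[of _ "\<lambda>_. 0"])

lemma form_combs_add:
  assumes "p \<in> form_combs n c i j" "q \<in> form_combs n c i j"
  shows "p + q \<in> form_combs n c i j"
proof -
  obtain g h where "p = (\<Sum>a<i. lin n (c a) * g a)" "q = (\<Sum>a<i. lin n (c a) * h a)"
    "\<forall>a<i. g a \<in> homog n (j - 1)" "\<forall>a<i. h a \<in> homog n (j - 1)"
    using assms unfolding form_combs_def by blast
  then show ?thesis unfolding form_combs_def
    by (auto intro!: exI[of _ "\<lambda>a. g a + h a"] simp: algebra_simps sum.distrib homog_add)
qed

lemma form_combs_mult:
  assumes "q \<in> homog n k" "p \<in> form_combs n c i j"
  shows "q * p \<in> form_combs n c i (k + j)"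
proof -
  obtain g where "p = (\<Sum>a<i. lin n (c a) * g a)" "\<forall>a<i. g a \<in> homog n (j - 1)"
    using assms unfolding form_combs_def by blast
  then show ?thesis unfolding form_combs_def using assms(1)
    by (auto intro!: exI[of _ "\<lambda>a. q * g a"] homog_mult' simp: algebra_simps sum_distrib_left)
qed

lemma form_combs_generator:
  assumes "a < i" "g \<in> homog n (j - 1)"
  shows "lin n (c a) * g \<in> form_combs n c i j"
  unfolding form_combs_def using assms
  by (auto intro!: exI[of _ "\<lambda>b. if b = a then g else 0"] simp: if_distrib sum.delta cong: if_cong)

lemma form_combs_Suc:
  "p \<in> form_combs n c (Suc i) j \<longleftrightarrow> (\<exists>q\<in>form_combs n c i j. \<exists>g\<in>homog n (j - 1). p = q + lin n (c i) * g)"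
    (is "?L \<longleftrightarrow> ?R")
proof
  assume ?L then show ?R unfolding form_combs_def by fastforce
next
  assume ?R
  then obtain h g where "p = (\<Sum>a<i. lin n (c a) * h a) + lin n (c i) * g"
    "\<forall>a<i. h a \<in> homog n (j - 1)" "g \<in> homog n (j - 1)"
    unfolding form_combs_def by blast
  then show ?L unfolding form_combs_def
    by (auto intro!: exI[of _ "h(i := g)"] simp: less_Suc_eq)
qed

lemma form_combs_homog: "p \<in> form_combs n c i j \<Longrightarrow> p \<in> homog n j"
  unfolding form_combs_def by (auto intro!: homog_sum homog_mult'[OF lin_homog])

lemma form_combs_eval: "p \<in> form_combs n c i j \<Longrightarrow> (\<And>a. a < i \<Longrightarrow> dot n (c a) v = 0) \<Longrightarrow> eval_poly v p = 0"
  unfolding form_combs_def by (auto simp: eval_sum eval_mult eval_lin_dot)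

text \<open>The degree \<open>j\<close> piece of I + Y_i, where I is the ideal of \<open>S\<close>.
  For \<open>S\<close> a union of linear spaces, I is the intersection of their ideals, see
  \<open>vanishing_ideal_homog\<close>.\<close>

definition ideal_plus :: "nat \<Rightarrow> (nat \<Rightarrow> 'k::field) set \<Rightarrow> (nat \<Rightarrow> nat \<Rightarrow> 'k) \<Rightarrow> nat \<Rightarrow> int \<Rightarrow> 'k mpoly set" where
  "ideal_plus n S c i j = {p + h | p h. p \<in> vanish n S j \<and> h \<in> form_combs n c i j}"

lemma ideal_plusI: "p \<in> vanish n S j \<Longrightarrow> h \<in> form_combs n c i j \<Longrightarrow> p + h \<in> ideal_plus n S c i j"
  unfolding ideal_plus_def by blast

lemma ideal_plus_vanish: "p \<in> vanish n S j \<Longrightarrow> p \<in> ideal_plus n S c i j"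
  using ideal_plusI[of p n S j 0] by simp

lemma ideal_plus_forms: "p \<in> form_combs n c i j \<Longrightarrow> p \<in> ideal_plus n S c i j"
  using ideal_plusI[of 0 n S j p] by simp

lemma ideal_plus_add: "p \<in> ideal_plus n S c i j \<Longrightarrow> q \<in> ideal_plus n S c i j \<Longrightarrow> p + q \<in> ideal_plus n S c i j"
proof -
  assume "p \<in> ideal_plus n S c i j" "q \<in> ideal_plus n S c i j"
  then obtain p1 p2 q1 q2 where *: "p = p1 + p2" "q = q1 + q2" "p1 \<in> vanish n S j" "q1 \<in> vanish n S j"
    "p2 \<in> form_combs n c i j" "q2 \<in> form_combs n c i j"
    unfolding ideal_plus_def by blast
  have "p + q = (p1 + q1) + (p2 + q2)" using * by simp
  moreover have "(p1 + q1) + (p2 + q2) \<in> ideal_plus n S c i j"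
    using * by (intro ideal_plusI vanish_add form_combs_add)
  ultimately show ?thesis by simp
qed

lemma ideal_plus_mult: "q \<in> homog n k \<Longrightarrow> p \<in> ideal_plus n S c i j \<Longrightarrow> q * p \<in> ideal_plus n S c i (k + j)"
proof -
  assume q: "q \<in> homog n k" and "p \<in> ideal_plus n S c i j"
  then obtain p1 p2 where "p = p1 + p2" "p1 \<in> vanish n S j" "p2 \<in> form_combs n c i j"
    unfolding ideal_plus_def by blast
  then show ?thesis
    using ideal_plusI[OF vanish_mult[OF q] form_combs_mult[OF q]] by (simp add: distrib_left)
qed

lemma ideal_plus_uminus: "p \<in> ideal_plus n S c i j \<Longrightarrow> - p \<in> ideal_plus n S c i j"
  using ideal_plus_mult[OF homog_const[of "- 1"], of p n S c i j] by (simp add: single_uminus)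

lemma ideal_plus_diff: "p \<in> ideal_plus n S c i j \<Longrightarrow> q \<in> ideal_plus n S c i j \<Longrightarrow> p - q \<in> ideal_plus n S c i j"
  using ideal_plus_add[OF _ ideal_plus_uminus, of p n S c i j q] by simp

lemma ideal_plus_Suc:
  "p \<in> ideal_plus n S c (Suc i) j \<longleftrightarrow> (\<exists>q\<in>ideal_plus n S c i j. \<exists>g\<in>homog n (j - 1). p = q + lin n (c i) * g)"
    (is "?L \<longleftrightarrow> ?R")
proof
  assume ?L
  then obtain p1 p2 g where "p1 \<in> vanish n S j" "p2 \<in> form_combs n c i j" "g \<in> homog n (j - 1)"
    "p = p1 + (p2 + lin n (c i) * g)"
    unfolding ideal_plus_def mem_Collect_eq form_combs_Suc by blast
  then show ?R by (intro bexI[of _ "p1 + p2"] bexI[of _ g]) (auto intro: ideal_plusI)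
next
  assume ?R
  then obtain p1 p2 g where *: "p1 \<in> vanish n S j" "p2 \<in> form_combs n c i j" "g \<in> homog n (j - 1)"
    "p = (p1 + p2) + lin n (c i) * g"
    unfolding ideal_plus_def by blast
  then have "p2 + lin n (c i) * g \<in> form_combs n c (Suc i) j" by (auto simp: form_combs_Suc)
  with * show ?L by (auto simp: add.assoc intro: ideal_plusI)
qed

text \<open>The vectors \<open>v b\<close> lie in all the spaces and are triangular against the
  forms. Projecting along \<open>v (i - 1)\<close>, ..., \<open>v 0\<close> in turn changes
  \<open>u\<close> only by multiples of y_{i-1}, ..., y_0 and ends with a polynomial vanishing on
  every \<open>V a\<close>.\<close>

lemma projection_to_subspaces:
  assumes V: "\<And>a. a \<in> A \<Longrightarrow> linear_space n (V a)"
    and v: "\<And>b a. b < i \<Longrightarrow> a \<in> A \<Longrightarrow> v b \<in> V a"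
    and v0: "\<And>b b'. b < i \<Longrightarrow> b' < b \<Longrightarrow> dot n (c b') (v b) = 0"
    and v1: "\<And>b. b < i \<Longrightarrow> dot n (c b) (v b) = 1"
    and u: "u \<in> homog n j"
    and u0: "\<And>a z. a \<in> A \<Longrightarrow> z \<in> V a \<Longrightarrow> (\<And>b. b < i \<Longrightarrow> dot n (c b) z = 0) \<Longrightarrow> eval_poly z u = 0"
  shows "u \<in> ideal_plus n (\<Union>a\<in>A. V a) c i j"
  using v v0 v1 u u0
proof (induction i arbitrary: u)
  case 0
  then show ?case by (intro ideal_plus_vanish) (auto simp: vanish_def)
next
  case (Suc i)
  obtain u' g where *: "u' \<in> homog n j" "g \<in> homog n (j - 1)" "u = u' + lin n (c i) * g"
    "\<And>z. eval_poly z u' = eval_poly (\<lambda>k. z k - eval_poly z (lin n (c i)) * v i k) u"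
    using projection_homog[OF Suc.prems(4), of "c i" "v i"] by blast
  have "u' \<in> ideal_plus n (\<Union>a\<in>A. V a) c i j"
  proof (rule Suc.IH)
    fix a z assume az: "a \<in> A" "z \<in> V a" "\<And>b. b < i \<Longrightarrow> dot n (c b) z = 0"
    show "eval_poly z u' = 0"
      unfolding *(4) eval_lin_dot
    proof (rule Suc.prems(5)[OF az(1)])
      \<comment> \<open>The projection of \<open>z\<close> stays in \<open>V a\<close> because
        \<open>v i\<close> lies there. It keeps y_b = 0 for \<open>b < i\<close>, as y_b is 0 at
        \<open>v i\<close>, and it makes y_i zero, as y_i is 1 at \<open>v i\<close>.\<close>
      show "(\<lambda>k. z k - dot n (c i) z * v i k) \<in> V a"
        using az Suc.prems(1) by (intro linear_space_diff_scale[OF V]) auto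
      show "dot n (c b) (\<lambda>k. z k - dot n (c i) z * v i k) = 0" if "b < Suc i" for b
        using that az(3) Suc.prems(2,3)[of i] by (cases "b = i") (auto simp: dot_diff_scale)
    qed
  qed (use Suc.prems * in auto)
  then show ?case using * by (auto simp: ideal_plus_Suc)
qed

text \<open>All subfamilies \<open>A\<close> are covered since the induction in
  \<open>colon_ideal\<close> removes spaces one at a time. The sequence \<open>c\<close> is
  infinite, so that \<open>y (Suc i)\<close> makes sense there also for
  \<open>i = n\<close>.\<close>

locale generic_forms =
  fixes n :: nat and D :: "'i set" and V :: "'i \<Rightarrow> (nat \<Rightarrow> 'k::field) set" and c :: "nat \<Rightarrow> nat \<Rightarrow> 'k"
  assumes inf: "infinite (UNIV :: 'k set)"
    and V: "\<And>a. a \<in> D \<Longrightarrow> linear_space n (V a)"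
    and c: "\<And>i. c i \<in> coord_space n"
    and generic: "\<And>A i z. A \<subseteq> D \<Longrightarrow> z \<in> coord_space n \<Longrightarrow> z \<noteq> 0 \<Longrightarrow> (\<And>a. a \<in> A \<Longrightarrow> z \<in> V a) \<Longrightarrow>
        (\<And>b. b < i \<Longrightarrow> dot n (c b) z = 0) \<Longrightarrow>
        \<exists>z\<in>coord_space n. (\<forall>a\<in>A. z \<in> V a) \<and> (\<forall>b<i. dot n (c b) z = 0) \<and> dot n (c i) z \<noteq> 0"
    and separating: "\<And>z. z \<in> coord_space n \<Longrightarrow> (\<And>b. b < Suc n \<Longrightarrow> dot n (c b) z = 0) \<Longrightarrow> z = 0"
begin

abbreviation "y a \<equiv> lin n (c a)"

abbreviation "IY A \<equiv> ideal_plus n (\<Union>a\<in>A. V a) c"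

text \<open>On a line inside \<open>S\<close> in direction \<open>z\<close> the form becomes a
  polynomial of degree one in \<open>t\<close> and \<open>u\<close> a polynomial \<open>P\<close>.
  Their product vanishes on an infinite field, so \<open>P\<close> is zero.\<close>

lemma line_cancel:
  fixes f :: "nat \<Rightarrow> 'k"
  assumes VA: "\<And>v t. v \<in> S \<Longrightarrow> (\<lambda>k. v k + t * z k) \<in> S"
    and z: "dot n f z \<noteq> 0" and u: "\<And>v. v \<in> S \<Longrightarrow> eval_poly v (lin n f * u) = 0" and v: "v \<in> S"
  shows "eval_poly v u = 0"
proof -
  obtain P where P: "\<And>t. eval_poly (\<lambda>k. v k + t * z k) u = poly P t"
    using eval_on_line by metis
  have "(dot n f v + t * dot n f z) * poly P t = 0" for t
    using u[OF VA[OF v, of t]] by (simp add: eval_mult eval_lin_dot P dot_add dot_scale)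
  then have "poly ([:dot n f v, dot n f z:] * P) t = 0" for t
    by (simp add: algebra_simps)
  then have roots: "{t. poly ([:dot n f v, dot n f z:] * P) t = 0} = UNIV" by simp
  have "[:dot n f v, dot n f z:] * P = 0"
  proof (rule ccontr)
    assume "[:dot n f v, dot n f z:] * P \<noteq> 0"
    from poly_roots_finite[OF this] show False unfolding roots using inf by contradiction
  qed
  then have "[:dot n f v, dot n f z:] = 0 \<or> P = 0" by (simp only: mult_eq_0_iff)
  then have "P = 0" using z by auto
  then show ?thesis using P[of 0] by simp
qed

text \<open>The case in which the cones share a nonzero point killed by y_0, ..., y_{i-1}.
  Projection identifies I + Y_i with the polynomials vanishing on the sections of the
  \<open>V a\<close> by these forms. Each section contains a vector with y_i = 1, so y_i cancels
  there, in every degree.\<close>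

lemma colon_nonzero:
  assumes A: "A \<subseteq> D" "A \<noteq> {}" and z: "z \<in> coord_space n" "z \<noteq> 0" "\<And>a. a \<in> A \<Longrightarrow> z \<in> V a" "\<And>b. b < i \<Longrightarrow> dot n (c b) z = 0"
    and u: "u \<in> homog n j" and yu: "y i * u \<in> IY A i k"
  shows "u \<in> IY A i j"
proof -
  \<comment> \<open>The point \<open>z\<close> is killed by the forms below \<open>b\<close> too, so
    \<open>generic\<close> applies at each \<open>b \<le> i\<close>; scaling normalises the value to
    1.\<close>
  have ex: "\<exists>w. (\<forall>a\<in>A. w \<in> V a) \<and> (\<forall>b'<b. dot n (c b') w = 0) \<and> dot n (c b) w = 1" if b: "b \<le> i" for b
  proof -
    obtain w where w: "\<forall>a\<in>A. w \<in> V a" "\<forall>b'<b. dot n (c b') w = 0" "dot n (c b) w \<noteq> 0"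
      using generic[OF A(1) z(1,2), of b] z b by auto
    have "(\<lambda>k. inverse (dot n (c b) w) * w k) \<in> V a" if "a \<in> A" for a
      using w that A by (intro linear_space_scale[OF V]) auto
    then show ?thesis using w
      by (intro exI[of _ "\<lambda>k. inverse (dot n (c b) w) * w k"]) (auto simp: dot_scale)
  qed
  then obtain v where v: "\<And>b. b \<le> i \<Longrightarrow> (\<forall>a\<in>A. v b \<in> V a) \<and> (\<forall>b'<b. dot n (c b') (v b) = 0) \<and> dot n (c b) (v b) = 1"
    by metis
  show ?thesis
  proof (rule projection_to_subspaces[where v = v])
    fix a w assume aw: "a \<in> A" "w \<in> V a" "\<And>b. b < i \<Longrightarrow> dot n (c b) w = 0"
    let ?S = "{w \<in> V a. \<forall>b<i. dot n (c b) w = 0}"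
    show "eval_poly w u = 0"
    proof (rule line_cancel[of ?S])
      show "(\<lambda>k. w k + t * v i k) \<in> ?S" if "w \<in> ?S" for w t
        using that v[of i] aw A by (auto simp: dot_add dot_scale intro!: linear_space_add_scale[OF V])
      show "dot n (c i) (v i) \<noteq> 0" using v by simp
      fix w assume "w \<in> ?S"
      moreover obtain p h where "p \<in> vanish n (\<Union>a\<in>A. V a) k" "h \<in> form_combs n c i k" "y i * u = p + h"
        using yu unfolding ideal_plus_def by blast
      ultimately show "eval_poly w (y i * u) = 0"
        using aw by (auto simp: eval_add vanish_def form_combs_eval)
    qed (use aw in auto)
    next
    show "linear_space n (V a)" if "a \<in> A" for a using V A that by blast
  qed (use v u in auto)
qed

lemma span_multiply:
  assumes "x \<in> fv.span X" and g: "g \<in> homog n j"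
    and X: "\<And>x. x \<in> X \<Longrightarrow> lin n x * g \<in> IY A i (j + 1)"
  shows "lin n x * g \<in> IY A i (j + 1)"
  using assms(1)
proof (induction rule: fv.span_induct_alt)
  case base
  then show ?case by (simp add: lin_def ideal_plus_forms)
next
  case (step a x z)
  have "lin n ((\<lambda>i. a * x i) + z) = single 0 a * lin n x + lin n z"
    by (simp add: plus_fun_def lin_add lin_scale)
  moreover have "single 0 a * (lin n x * g) \<in> IY A i (j + 1)"
    using ideal_plus_mult[OF homog_const[of a] X[OF step(1)]] by simp
  ultimately show ?case
    using ideal_plus_add[OF _ step(2)] by (simp only: distrib_right mult.assoc)
qed

text \<open>By \<open>forms_span\<close> the annihilators and the y_b with \<open>b < i\<close> span
  all linear forms, and y_b * g lies in Y_i anyway, so only annihilators have to be tested.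
  \<open>A\<close> supplies the spanning forms, \<open>B\<close> the target ideal.\<close>

lemma linear_multiply:
  assumes A: "A \<subseteq> D" and zero: "\<And>z. z \<in> coord_space n \<Longrightarrow> (\<And>a. a \<in> A \<Longrightarrow> z \<in> V a) \<Longrightarrow> (\<And>b. b < i \<Longrightarrow> dot n (c b) z = 0) \<Longrightarrow> z = 0"
    and g: "g \<in> homog n j"
    and ann: "\<And>a x. a \<in> A \<Longrightarrow> x \<in> annihilator n (V a) \<Longrightarrow> lin n x * g \<in> IY B i (j + 1)"
    and x: "x \<in> coord_space n"
  shows "lin n x * g \<in> IY B i (j + 1)"
proof (rule span_multiply[OF _ g])
  show "x \<in> fv.span (c ` {..<i} \<union> (\<Union>a\<in>A. annihilator n (V a)))"
    using A V c zero by (intro forms_span[OF _ _ _ x]) auto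
  show "lin n x * g \<in> IY B i (j + 1)" if "x \<in> c ` {..<i} \<union> (\<Union>a\<in>A. annihilator n (V a))" for x
    using that ann ideal_plus_forms[OF form_combs_generator[where j = "j + 1"]] g by auto
qed

text \<open>By \<open>separating\<close> the forms y_0, ..., y_n span all variables, and a monomial
  of positive degree is a variable times another monomial.\<close>

lemma homog_pos_generated:
  assumes "u \<in> homog n j" "j \<ge> 1"
  shows "u \<in> IY A (Suc n) j"
  using assms(1)
proof (induction rule: homog_induct)
  case (mono m a)
  then have "m \<noteq> 0" using assms(2) by auto
  then obtain i m' where m: "i \<in> keys m" "m = single i 1 + m'" by (rule monomial_split)
  then have i: "i \<le> n" using mono by auto
  let ?e = "\<lambda>k. if k = i then 1 else 0 :: 'k"
  have "lin n ?e = (\<Sum>k\<le>n. if k = i then single (single i 1) 1 else 0)"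
    unfolding lin_def by (intro sum.cong) auto
  then have "lin n ?e = single (single i 1) 1" using i by simp
  then have "single m a = lin n ?e * single m' a" using m by (simp add: mult_single)
  moreover have "lin n ?e * single m' a \<in> IY A (Suc n) ((j - 1) + 1)"
  proof (rule linear_multiply[where A = "{}"])
    show "single m' a \<in> homog n (j - 1)"
      using mono m by (intro homog_single) (auto simp: keys_exponent_add monom_deg_add)
    show "?e \<in> coord_space n" using i by (auto simp: coord_space_def)
  qed (use separating in auto)
  ultimately show ?case by simp
qed (auto intro: ideal_plus_add ideal_plus_forms)

subsection \<open>Regularity of the generic forms modulo the arrangement\<close>

text \<open>Strong induction on the number of spaces and, inside it, descending induction on
  \<open>i\<close>. The latter starts at \<open>n + 1\<close>, where positive degree alone
  suffices.\<close>

theorem colon_ideal: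
  assumes "finite A" "A \<subseteq> D" "i < Suc n" "int (card A) \<le> j" "u \<in> homog n j" "y i * u \<in> IY A i (j + 1)"
  shows "u \<in> IY A i j"
  using assms
proof (induction "card A" arbitrary: A i j u rule: less_induct)
  case (less A i j u)
  show ?case
  proof (cases "A = {}")
    case True
    then show ?thesis using less.prems by (intro ideal_plus_vanish) (auto simp: vanish_def)
  next
    case False
    \<comment> \<open>For \<open>i = n + 1\<close>, where no form \<open>y\<^sub>i\<close> is left, \<open>Q\<close> asks that \<open>I + Y\<^sub>n\<^sub>+\<^sub>1\<close> is everything in degree \<open>j\<close>.\<close>
    define Q where "Q = (\<lambda>i. \<forall>j u. int (card A) \<le> j \<longrightarrow> u \<in> homog n j \<longrightarrow>
      (if i < Suc n then y i * u \<in> IY A i (j + 1) else True) \<longrightarrow> u \<in> IY A i j)"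
    have "Q i" if "i \<le> Suc n" for i
      using that
    proof (induction i rule: inc_induct)
      case base
      have "card A \<ge> 1" using False less.prems(1) by (simp add: Suc_le_eq card_gt_0_iff)
      then show ?case unfolding Q_def by (auto intro!: homog_pos_generated)
    next
      case (step i)
      show ?case
      proof (cases "\<exists>z\<in>coord_space n. z \<noteq> 0 \<and> (\<forall>a\<in>A. z \<in> V a) \<and> (\<forall>b<i. dot n (c b) z = 0)")
        case True
        then show ?thesis
          unfolding Q_def using colon_nonzero[OF less.prems(2) False] step.hyps by auto
      next
        case zero: False
        \<comment> \<open>After removal of \<open>a\<close> the degree bound drops to
          \<open>card A - 1\<close>, so y_i can be cancelled twice, in degrees \<open>j + 1\<close>
          and \<open>j\<close>. This puts \<open>w\<close> in J_a + Y_i, and a form vanishing on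
          \<open>V a\<close> carries J_a into I.\<close>
        have all: "lin n x * w \<in> IY A i (j + 1)"
          if w: "w \<in> homog n j" "int (card A) - 1 \<le> j" "y i * (y i * w) \<in> IY A i (j + 2)"
            and x: "x \<in> coord_space n" for w j x
        proof (rule linear_multiply[OF less.prems(2) _ w(1) _ x])
          fix a f assume a: "a \<in> A" and f: "f \<in> annihilator n (V a)"
          let ?B = "A - {a}"
          have card: "card ?B < card A" "int (card ?B) = int (card A) - 1"
            using card.remove[OF less.prems(1) a] by simp_all
          have sub: "IY A i k \<subseteq> IY ?B i k" for k
            by (auto simp: ideal_plus_def vanish_def)
          have B: "finite ?B" "?B \<subseteq> D" using less.prems by auto
          have "y i * (y i * w) \<in> IY ?B i (j + 1 + 1)"
            using subsetD[OF sub w(3)] by (simp only: add.assoc one_add_one)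
          moreover have "y i * w \<in> homog n (j + 1)"
            using w(1) by (intro homog_mult'[OF lin_homog]) auto
          ultimately have "y i * w \<in> IY ?B i (j + 1)"
            using w(2) card(2) step.hyps by - (rule less.hyps[OF card(1) B], auto)
          then have "w \<in> IY ?B i j"
            using w(1,2) card(2) step.hyps by - (rule less.hyps[OF card(1) B], auto)
          then obtain p h where ph: "w = p + h" "p \<in> vanish n (\<Union>a\<in>?B. V a) j" "h \<in> form_combs n c i j"
            unfolding ideal_plus_def by blast
          have "lin n f * p \<in> homog n (1 + j)" "lin n f * h \<in> form_combs n c i (1 + j)"
            using ph by (auto simp: vanish_def intro!: homog_mult form_combs_mult lin_homog)
          moreover have "eval_poly v (lin n f * p) = 0" if "v \<in> V b" "b \<in> A" for v b
            using that ph(2) f by (cases "b = a") (auto simp: eval_mult eval_lin_dot annihilator_def vanish_def)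
          ultimately show "lin n f * w \<in> IY A i (j + 1)"
            unfolding ph(1) distrib_left by (intro ideal_plusI) (auto simp: vanish_def add.commute)
        qed (use zero in blast)
        show ?thesis unfolding Q_def
        proof (intro allI impI)
          fix j u assume j: "int (card A) \<le> j" and u: "u \<in> homog n j"
            and "if i < Suc n then y i * u \<in> IY A i (j + 1) else True"
          then have yu: "y i * u \<in> IY A i (j + 1)" using step by simp
          have "y i * (y i * u) \<in> IY A i (j + 2)"
            using ideal_plus_mult[OF lin_homog yu] by (simp add: add.commute)
          \<comment> \<open>Applying \<open>all\<close> to \<open>u\<close> and the form y_{i+1}
            provides the hypothesis of \<open>Q (Suc i)\<close>, which yields u = q + y_i v.\<close>
          then have "y (Suc i) * u \<in> IY A i (j + 1)"
            using all[OF u] j c by simp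
          then have "y (Suc i) * u \<in> IY A (Suc i) (j + 1)"
            unfolding ideal_plus_Suc by (intro bexI[of _ "y (Suc i) * u"] bexI[of _ 0]) auto
          then have "u \<in> IY A (Suc i) j" using step.IH j u unfolding Q_def by auto
          then obtain q v where qv: "q \<in> IY A i j" "v \<in> homog n (j - 1)" "u = q + y i * v"
            unfolding ideal_plus_Suc by blast
          \<comment> \<open>Now \<open>all\<close> is applied to \<open>v\<close>, whose degree
            \<open>j - 1\<close> is just large enough, and to the form y_i itself. Hence y_i v lies
            in I + Y_i, and so does \<open>u\<close>.\<close>
          have "y i * (y i * v) = y i * u - y i * q" using qv by (simp add: algebra_simps)
          also have "\<dots> \<in> IY A i (j + 1)"
            using yu ideal_plus_mult[OF lin_homog qv(1)] by (intro ideal_plus_diff) (auto simp: add.commute)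
          finally have "y i * v \<in> IY A i j"
            using all[OF qv(2) _ _ c[of i]] j by (simp add: algebra_simps)
          then show "u \<in> IY A i j" using qv by (auto intro: ideal_plus_add)
        qed
      qed
    qed
    then have "Q i" using less.prems by simp
    then show ?thesis unfolding Q_def using less.prems by auto
  qed
qed

end

subsection \<open>Homogeneous components\<close>

definition hcomp :: "int \<Rightarrow> 'k::field mpoly \<Rightarrow> 'k mpoly" where
  "hcomp j p = (\<Sum>m\<in>{m\<in>keys p. int (monom_deg m) = j}. single m (lookup p m))"

lemma lookup_hcomp: "lookup (hcomp j p) m = (if int (monom_deg m) = j then lookup p m else 0)"
  by (auto simp: hcomp_def lookup_sum lookup_single when_def sum.delta in_keys_iff)

lemma hcomp_homog: "p \<in> carrier (polyring n) \<Longrightarrow> hcomp j p \<in> homog n j"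
  by (auto simp: homog_iff polyring_carrier_iff in_keys_iff lookup_hcomp split: if_splits)

lemma hcomp_0 [simp]: "hcomp j 0 = 0"
  by (rule poly_mapping_eqI) (simp add: lookup_hcomp)

lemma hcomp_add: "hcomp j (p + q) = hcomp j p + hcomp j q"
  by (rule poly_mapping_eqI) (simp add: lookup_hcomp lookup_add)

lemma hcomp_sum: "hcomp j (sum f A) = (\<Sum>x\<in>A. hcomp j (f x))"
  by (induction A rule: infinite_finite_induct) (simp_all add: hcomp_add)

lemma hcomp_of_homog: "p \<in> homog n i \<Longrightarrow> hcomp j p = (if i = j then p else 0)"
  by (rule poly_mapping_eqI) (auto simp: lookup_hcomp homog_iff in_keys_iff)

lemma sum_hcomp:
  assumes "finite J" "\<And>m. m \<in> keys p \<Longrightarrow> int (monom_deg m) \<in> J"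
  shows "(\<Sum>j\<in>J. hcomp j p) = p"
proof (rule poly_mapping_eqI)
  fix m
  have "(\<Sum>j\<in>J. lookup (hcomp j p) m) = (if int (monom_deg m) \<in> J then lookup p m else 0)"
    using assms(1) by (simp add: lookup_hcomp)
  then show "lookup (\<Sum>j\<in>J. hcomp j p) m = lookup p m"
    using assms(2) by (auto simp: lookup_sum in_keys_iff)
qed

definition degrees :: "'k::field mpoly \<Rightarrow> int set" where
  "degrees p = (\<lambda>m. int (monom_deg m)) ` keys p"

lemma finite_degrees [simp]: "finite (degrees p)"
  by (simp add: degrees_def)

lemma sum_hcomp_degrees: "finite J \<Longrightarrow> degrees p \<subseteq> J \<Longrightarrow> (\<Sum>j\<in>J. hcomp j p) = p"
  by (rule sum_hcomp) (auto simp: degrees_def)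

lemma hcomp_notin_degrees: "j \<notin> degrees p \<Longrightarrow> hcomp j p = 0"
  by (rule poly_mapping_eqI) (auto simp: lookup_hcomp degrees_def in_keys_iff)

lemma hcomp_mult_homog:
  assumes p: "p \<in> carrier (polyring n)" and a: "a \<in> homog n i"
  shows "hcomp j (p * a) = hcomp (j - i) p * a"
proof -
  have "p * a = (\<Sum>k\<in>degrees p. hcomp k p * a)"
    by (subst sum_hcomp_degrees[symmetric, of "degrees p" p]) (simp_all add: sum_distrib_right)
  then have "hcomp j (p * a) = (\<Sum>k\<in>degrees p. hcomp j (hcomp k p * a))" by (simp add: hcomp_sum)
  also have "\<dots> = (\<Sum>k\<in>degrees p. if k = j - i then hcomp k p * a else 0)"
    using hcomp_of_homog[OF homog_mult[OF hcomp_homog[OF p] a]] by (intro sum.cong) auto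
  also have "\<dots> = hcomp (j - i) p * a"
    by (auto simp: hcomp_notin_degrees)
  finally show ?thesis .
qed

subsection \<open>Free modules\<close>

lemma sum_fun_apply: "(\<Sum>x\<in>A. f x) \<alpha> = (\<Sum>x\<in>A. f x \<alpha>)"
  by (induction A rule: infinite_finite_induct) auto

text \<open>Scalar multiplication on plain functions, so that the pointwise group structure of the
  function type replaces the record operations; \<open>free_module_simps\<close> links the
  two.\<close>

definition sm :: "'k::field mpoly \<Rightarrow> (nat \<Rightarrow> 'k mpoly) \<Rightarrow> nat \<Rightarrow> 'k mpoly" where
  "sm p v = (\<lambda>\<alpha>. p * v \<alpha>)"

lemma sm_apply [simp]: "sm p v \<alpha> = p * v \<alpha>"
  by (simp add: sm_def)

lemma sm_add: "sm p (u + v) = sm p u + sm p v" and sm_add_left: "sm (p + q) v = sm p v + sm q v"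
  and sm_mult: "sm (p * q) v = sm p (sm q v)"
  and sm_1 [simp]: "sm 1 v = v" and sm_0 [simp]: "sm p 0 = 0" and sm_0_left [simp]: "sm 0 v = 0"
  by (auto simp: fun_eq_iff algebra_simps)

lemma sm_sum: "sm p (\<Sum>x\<in>A. f x) = (\<Sum>x\<in>A. sm p (f x))"
  by (rule ext) (simp add: sum_fun_apply sum_distrib_left)

abbreviation "FM n b \<equiv> carrier (free_module n b)"

lemma FM_iff: "v \<in> FM n b \<longleftrightarrow> (\<forall>\<alpha><b. v \<alpha> \<in> carrier (polyring n)) \<and> (\<forall>\<alpha>\<ge>b. v \<alpha> = 0)"
  by (simp add: free_module_def)

lemma FM_coord: "v \<in> FM n b \<Longrightarrow> v \<alpha> \<in> carrier (polyring n)"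
  by (cases "\<alpha> < b") (auto simp: FM_iff)

lemma FM_iff': "v \<in> FM n b \<longleftrightarrow> (\<forall>\<alpha>. v \<alpha> \<in> carrier (polyring n)) \<and> (\<forall>\<alpha>\<ge>b. v \<alpha> = 0)"
  using FM_coord by (auto simp: FM_iff)

lemma FM_0 [simp]: "0 \<in> FM n b" by (simp add: FM_iff)

lemma FM_add: "u \<in> FM n b \<Longrightarrow> v \<in> FM n b \<Longrightarrow> u + v \<in> FM n b"
  by (simp add: FM_iff' poly_carrier_add)

lemma FM_sm: "p \<in> carrier (polyring n) \<Longrightarrow> v \<in> FM n b \<Longrightarrow> sm p v \<in> FM n b"
  by (simp add: FM_iff' poly_carrier_mult)

abbreviation "FG \<equiv> free_grading"

text \<open>The degree condition can run over all \<open>\<alpha>\<close>, since coordinates from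
  \<open>b\<close> on are 0 and 0 has every degree.\<close>

lemma FG_iff: "v \<in> FG n b e j \<longleftrightarrow> (\<forall>\<alpha>. v \<alpha> \<in> homog n (j - e \<alpha>)) \<and> (\<forall>\<alpha>\<ge>b. v \<alpha> = 0)"
  unfolding free_grading_def mem_Collect_eq FM_iff
  by (metis homog_0 homog_carrier not_le)

lemma FG_FM: "v \<in> FG n b e j \<Longrightarrow> v \<in> FM n b"
  by (simp add: free_grading_def)

lemma FG_0 [simp]: "0 \<in> FG n b e j" by (simp add: FG_iff)

lemma FG_add: "u \<in> FG n b e j \<Longrightarrow> v \<in> FG n b e j \<Longrightarrow> u + v \<in> FG n b e j"
  by (simp add: FG_iff homog_add)

lemma FG_diff: "u \<in> FG n b e j \<Longrightarrow> v \<in> FG n b e j \<Longrightarrow> u - v \<in> FG n b e j"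
  by (simp add: FG_iff homog_diff)

lemma FG_sm: "p \<in> homog n i \<Longrightarrow> v \<in> FG n b e j \<Longrightarrow> sm p v \<in> FG n b e (i + j)"
  by (auto simp: FG_iff intro!: homog_mult')

lemma FG_neg: "v \<in> FG n b e j \<Longrightarrow> (\<And>\<alpha>. \<alpha> < b \<Longrightarrow> j < e \<alpha>) \<Longrightarrow> v = 0"
  unfolding FG_iff fun_eq_iff by (metis diff_less_0_iff_less homog_neg not_le zero_fun_apply)

definition vcomp :: "(nat \<Rightarrow> int) \<Rightarrow> int \<Rightarrow> (nat \<Rightarrow> 'k::field mpoly) \<Rightarrow> nat \<Rightarrow> 'k mpoly" where
  "vcomp e j v = (\<lambda>\<alpha>. hcomp (j - e \<alpha>) (v \<alpha>))"

lemma vcomp_FG: "v \<in> FM n b \<Longrightarrow> vcomp e j v \<in> FG n b e j"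
  by (simp add: vcomp_def FG_iff FM_iff' hcomp_homog)

lemma vcomp_of_FG: "v \<in> FG n b e i \<Longrightarrow> vcomp e j v = (if i = j then v else 0)"
proof
  fix \<alpha>
  assume "v \<in> FG n b e i"
  then have "v \<alpha> \<in> homog n (i - e \<alpha>)" by (simp add: FG_iff)
  from hcomp_of_homog[OF this] show "vcomp e j v \<alpha> = (if i = j then v else 0) \<alpha>"
    by (simp add: vcomp_def)
qed

lemma FM_decompose:
  assumes "v \<in> FM n b"
  obtains J where "finite J" "v = (\<Sum>j\<in>J. vcomp e j v)"
proof
  \<comment> \<open>A term of degree k in coordinate \<open>\<alpha>\<close> has degree
    \<open>k + e \<alpha>\<close> in the twisted module.\<close>
  let ?J = "\<Union>\<alpha><b. (\<lambda>j. j + e \<alpha>) ` degrees (v \<alpha>)"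
  show "finite ?J" by auto
  show "v = (\<Sum>j\<in>?J. vcomp e j v)"
  proof
    fix \<alpha>
    show "v \<alpha> = (\<Sum>j\<in>?J. vcomp e j v) \<alpha>"
    proof (cases "\<alpha> < b")
      case True
      have "(\<Sum>j\<in>?J. vcomp e j v) \<alpha> = (\<Sum>j\<in>?J. hcomp (j - e \<alpha>) (v \<alpha>))"
        by (simp add: sum_fun_apply vcomp_def)
      also have "\<dots> = (\<Sum>j\<in>(\<lambda>j. j - e \<alpha>) ` ?J. hcomp j (v \<alpha>))"
        by (subst sum.reindex) (auto simp: inj_on_def)
      also have "\<dots> = v \<alpha>"
        using True by (intro sum_hcomp_degrees) (force simp: image_iff)+
      finally show ?thesis by simp
    next
      case False
      then show ?thesis using assms by (simp add: sum_fun_apply vcomp_def FM_iff)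
    qed
  qed
qed

definition graded_sub :: "nat \<Rightarrow> nat \<Rightarrow> (nat \<Rightarrow> int) \<Rightarrow> (nat \<Rightarrow> 'k::field mpoly) set \<Rightarrow> bool" where
  "graded_sub n b e N \<longleftrightarrow> N \<subseteq> FM n b \<and> 0 \<in> N \<and> (\<forall>u\<in>N. \<forall>v\<in>N. u + v \<in> N) \<and>
    (\<forall>p\<in>carrier (polyring n). \<forall>v\<in>N. sm p v \<in> N) \<and> (\<forall>v\<in>N. \<forall>j. vcomp e j v \<in> N)"

lemma graded_subD:
  assumes "graded_sub n b e N"
  shows "N \<subseteq> FM n b" "0 \<in> N" "u \<in> N \<Longrightarrow> v \<in> N \<Longrightarrow> u + v \<in> N"
    "p \<in> carrier (polyring n) \<Longrightarrow> v \<in> N \<Longrightarrow> sm p v \<in> N" "v \<in> N \<Longrightarrow> vcomp e j v \<in> N"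
  using assms by (auto simp: graded_sub_def)

lemma carrier_const: "single 0 a \<in> carrier (polyring n)"
  using homog_carrier[OF homog_const] .

lemma graded_sub_diff:
  assumes "graded_sub n b e N" "u \<in> N" "v \<in> N" shows "u - v \<in> N"
proof -
  have "u - v = u + sm (single 0 (- 1)) v" by (simp add: fun_eq_iff single_uminus)
  then show ?thesis using graded_subD[OF assms(1)] assms carrier_const by metis
qed

lemma graded_sub_sum: "graded_sub n b e N \<Longrightarrow> (\<And>x. x \<in> A \<Longrightarrow> f x \<in> N) \<Longrightarrow> sum f A \<in> N"
  by (induction A rule: infinite_finite_induct) (auto simp: graded_subD)

text \<open>The degree \<open>j\<close> piece of Y_i X, for a graded module X with pieces
  \<open>X j\<close>. It is taken for a free module F and for a submodule N, in order to compare Y_i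
  N with the part of N inside Y_i F.\<close>

definition vcombs :: "nat \<Rightarrow> (nat \<Rightarrow> nat \<Rightarrow> 'k::field) \<Rightarrow> (int \<Rightarrow> (nat \<Rightarrow> 'k mpoly) set) \<Rightarrow> nat \<Rightarrow> int \<Rightarrow>
    (nat \<Rightarrow> 'k mpoly) set" where
  "vcombs n c X i j = {\<Sum>a<i. sm (lin n (c a)) (f a) | f. \<forall>a<i. f a \<in> X (j - 1)}"

lemma vcombsI: "(\<And>a. a < i \<Longrightarrow> f a \<in> X (j - 1)) \<Longrightarrow> (\<Sum>a<i. sm (lin n (c a)) (f a)) \<in> vcombs n c X i j"
  unfolding vcombs_def by blast

lemma vcombsE:
  assumes "u \<in> vcombs n c X i j"
  obtains f where "u = (\<Sum>a<i. sm (lin n (c a)) (f a))" "\<forall>a<i. f a \<in> X (j - 1)"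
  using assms unfolding vcombs_def by blast

lemma vcombs_mono: "u \<in> vcombs n c X i j \<Longrightarrow> X (j - 1) \<subseteq> Y (j - 1) \<Longrightarrow> u \<in> vcombs n c Y i j"
  unfolding vcombs_def by blast

lemma vcombs_Suc:
  "u \<in> vcombs n c X (Suc i) j \<longleftrightarrow> (\<exists>q\<in>vcombs n c X i j. \<exists>g\<in>X (j - 1). u = q + sm (lin n (c i)) g)"
    (is "?L \<longleftrightarrow> ?R")
proof
  assume ?L
  then obtain f where "u = (\<Sum>a<i. sm (lin n (c a)) (f a)) + sm (lin n (c i)) (f i)"
    "\<And>a. a < Suc i \<Longrightarrow> f a \<in> X (j - 1)"
    by (auto elim: vcombsE)
  then show ?R by (intro bexI[of _ "\<Sum>a<i. sm (lin n (c a)) (f a)"] bexI[of _ "f i"]) (auto intro: vcombsI)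
next
  assume ?R
  then obtain h g where "u = (\<Sum>a<i. sm (lin n (c a)) (h a)) + sm (lin n (c i)) g"
    "\<forall>a<i. h a \<in> X (j - 1)" "g \<in> X (j - 1)"
    unfolding vcombs_def by blast
  then show ?L unfolding vcombs_def
    by (auto intro!: exI[of _ "h(i := g)"] simp: less_Suc_eq)
qed

lemma vcombs_add:
  assumes "u \<in> vcombs n c X i j" "v \<in> vcombs n c X i j"
    and X: "\<And>x y. x \<in> X (j - 1) \<Longrightarrow> y \<in> X (j - 1) \<Longrightarrow> x + y \<in> X (j - 1)"
  shows "u + v \<in> vcombs n c X i j"
proof -
  obtain f where f: "u = (\<Sum>a<i. sm (lin n (c a)) (f a))" "\<forall>a<i. f a \<in> X (j - 1)"
    using assms(1) by (rule vcombsE)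
  obtain g where g: "v = (\<Sum>a<i. sm (lin n (c a)) (g a))" "\<forall>a<i. g a \<in> X (j - 1)"
    using assms(2) by (rule vcombsE)
  have "u + v = (\<Sum>a<i. sm (lin n (c a)) (f a + g a))"
    unfolding f g sm_add sum.distrib ..
  moreover have "\<dots> \<in> vcombs n c X i j"
    using f g X by (intro vcombsI) simp
  ultimately show ?thesis by simp
qed

lemma vcombs_FG: "u \<in> vcombs n c (FG n b e) i j \<Longrightarrow> u \<in> FG n b e j"
proof (erule vcombsE)
  fix f assume u: "u = (\<Sum>a<i. sm (lin n (c a)) (f a))" "\<forall>a<i. f a \<in> FG n b e (j - 1)"
  have "sm (lin n (c a)) (f a) \<in> FG n b e j" if "a < i" for a
    using FG_sm[OF lin_homog u(2)[rule_format, OF that]] by simp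
  then show "u \<in> FG n b e j"
    unfolding u(1) by (induction i) (auto intro: FG_add)
qed

text \<open>Membership in Y_i F is a condition on each coordinate separately, which transfers facts
  about S to F.\<close>

lemma vcombs_FG_coord:
  "u \<in> vcombs n c (FG n b e) i j \<longleftrightarrow> u \<in> FG n b e j \<and> (\<forall>\<alpha>. u \<alpha> \<in> form_combs n c i (j - e \<alpha>))"
proof safe
  assume u: "u \<in> vcombs n c (FG n b e) i j"
  then show "u \<in> FG n b e j" by (rule vcombs_FG)
  fix \<alpha>
  obtain f where f: "u = (\<Sum>a<i. sm (lin n (c a)) (f a))" "\<forall>a<i. f a \<in> FG n b e (j - 1)"
    using u by (rule vcombsE)
  then show "u \<alpha> \<in> form_combs n c i (j - e \<alpha>)"
    unfolding form_combs_def by (auto simp: sum_fun_apply FG_iff algebra_simps intro!: exI[of _ "\<lambda>a. f a \<alpha>"])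
next
  assume u: "u \<in> FG n b e j" "\<forall>\<alpha>. u \<alpha> \<in> form_combs n c i (j - e \<alpha>)"
  then have "\<forall>\<alpha>. \<exists>g. u \<alpha> = (\<Sum>a<i. lin n (c a) * g a) \<and> (\<forall>a<i. g a \<in> homog n (j - e \<alpha> - 1))"
    unfolding form_combs_def by blast
  then obtain g where g: "\<And>\<alpha>. u \<alpha> = (\<Sum>a<i. lin n (c a) * g \<alpha> a) \<and> (\<forall>a<i. g \<alpha> a \<in> homog n (j - e \<alpha> - 1))"
    by metis
  have "u = (\<Sum>a<i. sm (lin n (c a)) (\<lambda>\<alpha>. if \<alpha> < b then g \<alpha> a else 0))"
  proof
    fix \<alpha> show "u \<alpha> = (\<Sum>a<i. sm (lin n (c a)) (\<lambda>\<alpha>. if \<alpha> < b then g \<alpha> a else 0)) \<alpha>"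
      using g[of \<alpha>] u(1) by (cases "\<alpha> < b") (auto simp: sum_fun_apply FG_iff)
  qed
  also have "\<dots> \<in> vcombs n c (FG n b e) i j"
    using g by (intro vcombsI) (auto simp: FG_iff algebra_simps)
  finally show "u \<in> vcombs n c (FG n b e) i j" .
qed

section \<open>Finite-dimensional graded pieces and finitely generated submodules\<close>

interpretation vv: vector_space "\<lambda>a v. sm (single 0 (a :: 'k::field)) v"
  by unfold_locales
     (auto simp: fun_eq_iff algebra_simps single_add mult_single simp flip: mult.assoc)

lemma finite_exponents: "finite {m :: nat \<Rightarrow>\<^sub>0 nat. keys m \<subseteq> {..n} \<and> monom_deg m = d}"
proof -
  let ?M = "{m :: nat \<Rightarrow>\<^sub>0 nat. keys m \<subseteq> {..n} \<and> monom_deg m = d}"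
  have "lookup m x \<le> d" if "m \<in> ?M" for m x
  proof (cases "x \<in> keys m")
    case True
    then have "lookup m x \<le> monom_deg m"
      unfolding monom_deg_def by (intro member_le_sum) auto
    with that show ?thesis by simp
  qed (simp add: in_keys_iff)
  moreover have "lookup m x = 0" if "m \<in> ?M" "\<not> x \<le> n" for m x
    using that by (metis (mono_tags, lifting) atMost_iff in_keys_iff mem_Collect_eq subsetD)
  ultimately have "lookup ` ?M \<subseteq> {f. \<forall>x. (x \<in> {..n} \<longrightarrow> f x \<in> {..d}) \<and> (x \<notin> {..n} \<longrightarrow> f x = 0)}"
    by auto
  moreover have "finite {f. \<forall>x. (x \<in> {..n} \<longrightarrow> f x \<in> {..d}) \<and> (x \<notin> {..n} \<longrightarrow> f x = (0::nat))}"
    by (rule finite_set_of_finite_funs) auto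
  ultimately have "finite (lookup ` ?M)" by (rule finite_subset)
  then show ?thesis
    by (rule finite_imageD) (simp add: inj_on_def poly_mapping.lookup_inject)
qed

lemma FG_finite_span:
  obtains T :: "(nat \<Rightarrow> 'k::field mpoly) set" where "finite T" "FG n b e j \<subseteq> vv.span T"
proof
  \<comment> \<open>For \<open>j < e \<alpha>\<close> the truncation by \<open>nat\<close> gives
    degree 0, which only enlarges the spanning set.\<close>
  let ?M = "\<lambda>\<alpha>. {m :: nat \<Rightarrow>\<^sub>0 nat. keys m \<subseteq> {..n} \<and> monom_deg m = nat (j - e \<alpha>)}"
  let ?u = "\<lambda>\<alpha> m. (\<lambda>\<beta>. if \<beta> = \<alpha> then single m 1 else 0) :: nat \<Rightarrow> 'k mpoly"
  let ?T = "\<Union>\<alpha><b. ?u \<alpha> ` ?M \<alpha>"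
  show "finite ?T" using finite_exponents by auto
  show "FG n b e j \<subseteq> vv.span ?T"
  proof
    fix v :: "nat \<Rightarrow> 'k mpoly" assume v: "v \<in> FG n b e j"
    have "v = (\<Sum>\<alpha><b. \<Sum>m\<in>keys (v \<alpha>). sm (single 0 (lookup (v \<alpha>) m)) (?u \<alpha> m))"
    proof
      fix \<beta>
      have "(\<Sum>\<alpha><b. \<Sum>m\<in>keys (v \<alpha>). sm (single 0 (lookup (v \<alpha>) m)) (?u \<alpha> m)) \<beta> =
          (\<Sum>\<alpha><b. if \<alpha> = \<beta> then \<Sum>m\<in>keys (v \<beta>). single m (lookup (v \<beta>) m) else 0)"
        unfolding sum_fun_apply by (intro sum.cong) (auto simp: mult_single intro!: sum.neutral)
      also have "\<dots> = v \<beta>"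
        using v poly_sum_singles[of "v \<beta>"] by (auto simp: FG_iff)
      finally show "v \<beta> = (\<Sum>\<alpha><b. \<Sum>m\<in>keys (v \<alpha>). sm (single 0 (lookup (v \<alpha>) m)) (?u \<alpha> m)) \<beta>" ..
    qed
    also have "\<dots> \<in> vv.span ?T"
    proof (intro vv.span_sum vv.span_scale vv.span_base)
      fix \<alpha> m assume "\<alpha> \<in> {..<b}" "m \<in> keys (v \<alpha>)"
      moreover have "v \<alpha> \<in> homog n (j - e \<alpha>)" using v by (simp add: FG_iff)
      ultimately show "?u \<alpha> m \<in> ?T" by (fastforce simp: homog_iff)
    qed
    finally show "v \<in> vv.span ?T" .
  qed
qed

text \<open>The S-submodule generated by a finite set \<open>G\<close>, with coefficients indexed by
  the generators themselves.\<close>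

definition scomb :: "nat \<Rightarrow> (nat \<Rightarrow> 'k::field mpoly) set \<Rightarrow> (nat \<Rightarrow> 'k mpoly) set" where
  "scomb n G = {\<Sum>g\<in>G. sm (q g) g | q. \<forall>g\<in>G. q g \<in> carrier (polyring n)}"

lemma scomb_add:
  assumes "u \<in> scomb n G" "v \<in> scomb n G" shows "u + v \<in> scomb n G"
proof -
  obtain q r where "u = (\<Sum>g\<in>G. sm (q g) g)" "v = (\<Sum>g\<in>G. sm (r g) g)"
    "\<forall>g\<in>G. q g \<in> carrier (polyring n)" "\<forall>g\<in>G. r g \<in> carrier (polyring n)"
    using assms unfolding scomb_def by blast
  then show ?thesis unfolding scomb_def
    by (auto intro!: exI[of _ "\<lambda>g. q g + r g"] poly_carrier_add simp: sm_add_left sum.distrib)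
qed

lemma scomb_sm:
  assumes "u \<in> scomb n G" "p \<in> carrier (polyring n)" shows "sm p u \<in> scomb n G"
proof -
  obtain q where "u = (\<Sum>g\<in>G. sm (q g) g)" "\<forall>g\<in>G. q g \<in> carrier (polyring n)"
    using assms unfolding scomb_def by blast
  then show ?thesis unfolding scomb_def using assms(2)
    by (auto intro!: exI[of _ "\<lambda>g. p * q g"] poly_carrier_mult simp: sm_mult sm_sum)
qed

lemma scomb_0 [simp]: "0 \<in> scomb n G"
  unfolding scomb_def by (auto intro!: exI[of _ "\<lambda>g. 0"])

lemma scomb_sum: "(\<And>x. x \<in> A \<Longrightarrow> f x \<in> scomb n G) \<Longrightarrow> sum f A \<in> scomb n G"
  by (induction A rule: infinite_finite_induct) (auto intro: scomb_add)

lemma scomb_base: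
  assumes "finite G" "g \<in> G" shows "g \<in> scomb n G"
proof -
  have "(\<Sum>h\<in>G. sm (if h = g then 1 else 0) h) = (\<Sum>h\<in>G. if h = g then h else 0)"
    by (intro sum.cong) auto
  also have "\<dots> = g" using assms by simp
  finally show ?thesis unfolding scomb_def
    by (auto intro!: exI[of _ "\<lambda>h. if h = g then 1 else 0"] simp: polyring_carrier_iff split: if_splits)
qed

lemma scomb_span: "finite G \<Longrightarrow> vv.span B \<subseteq> scomb n G" if "B \<subseteq> scomb n G"
proof (rule vv.span_minimal[OF that])
  show "vv.subspace (scomb n G)"
    by (rule vv.subspaceI) (auto intro: scomb_add scomb_sm carrier_const)
qed

lemma vcombs_FG_sm: "p \<in> homog n k \<Longrightarrow> u \<in> vcombs n c (FG n b e) i j \<Longrightarrow> sm p u \<in> vcombs n c (FG n b e) i (k + j)"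
  unfolding vcombs_FG_coord
  using form_combs_mult[of p n k] by (auto intro: FG_sm simp: add_diff_eq[symmetric])

lemma vcombs_FG_add: "u \<in> vcombs n c (FG n b e) i j \<Longrightarrow> v \<in> vcombs n c (FG n b e) i j \<Longrightarrow> u + v \<in> vcombs n c (FG n b e) i j"
  by (rule vcombs_add) (auto intro: FG_add)

lemma sm_minus_1: "sm (single 0 (- 1)) u = - u"
  by (simp add: fun_eq_iff single_uminus)

lemma vcombs_FG_uminus: "u \<in> vcombs n c (FG n b e) i j \<Longrightarrow> - u \<in> vcombs n c (FG n b e) i j"
  using vcombs_FG_sm[OF homog_const, of u n c b e i j "- 1"] by (simp add: sm_minus_1)

subsection \<open>Construction of the resolution\<close>

text \<open>What the construction of the resolution uses about S/Y_i. These are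
  \<open>colon_ideal\<close> and \<open>homog_pos_generated\<close> for a single space, the whole
  coordinate space with ideal 0; hence the bound \<open>1 \<le> j\<close>.\<close>

locale linear_forms_seq =
  fixes n :: nat and c :: "nat \<Rightarrow> nat \<Rightarrow> 'k::field"
  assumes reg: "\<And>i j u. i < Suc n \<Longrightarrow> 1 \<le> j \<Longrightarrow> u \<in> homog n j \<Longrightarrow>
      lin n (c i) * u \<in> form_combs n c i (j + 1) \<Longrightarrow> u \<in> form_combs n c i j"
    and gen: "\<And>j u. 1 \<le> j \<Longrightarrow> u \<in> homog n j \<Longrightarrow> u \<in> form_combs n c (Suc n) j"
begin

text \<open>The last clause says that \<open>y\<^sub>i\<close> is injective on \<open>M/Y\<^sub>iM\<close> in degrees above \<open>r\<close>, where \<open>M = F/N\<close>.\<close>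

definition stage :: "int \<Rightarrow> nat \<Rightarrow> (nat \<Rightarrow> int) \<Rightarrow> (nat \<Rightarrow> 'k mpoly) set \<Rightarrow> bool" where
  "stage r b e N \<longleftrightarrow> graded_sub n b e N \<and> (\<forall>\<alpha><b. 0 \<le> e \<alpha> \<and> e \<alpha> \<le> r) \<and>
    (\<forall>i<Suc n. \<forall>j>r. \<forall>u\<in>FG n b e j. \<forall>p\<in>N. \<forall>h\<in>vcombs n c (FG n b e) i (j + 1).
      sm (lin n (c i)) u = p + h \<longrightarrow> (\<exists>p'\<in>N. \<exists>h'\<in>vcombs n c (FG n b e) i j. u = p' + h'))"

context
  fixes r :: int and b :: nat and e :: "nat \<Rightarrow> int" and N :: "(nat \<Rightarrow> 'k mpoly) set"
  assumes stage: "stage r b e N"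
begin

lemma N: "graded_sub n b e N"
  using stage by (simp add: stage_def)

lemma twist_bounds: "\<alpha> < b \<Longrightarrow> 0 \<le> e \<alpha>" "\<alpha> < b \<Longrightarrow> e \<alpha> \<le> r"
  using stage by (auto simp: stage_def)

lemma stage_colon:
  assumes "i < Suc n" "j > r" "u \<in> FG n b e j" "p \<in> N" "h \<in> vcombs n c (FG n b e) i (j + 1)"
    "sm (lin n (c i)) u = p + h"
  obtains p' h' where "p' \<in> N" "h' \<in> vcombs n c (FG n b e) i j" "u = p' + h'"
  using stage assms unfolding stage_def by blast

definition "NG j = N \<inter> FG n b e j"

text \<open>In coordinate \<open>\<alpha>\<close> the assumption \<open>reg\<close> is applied in
  degree \<open>j - e \<alpha>\<close>, which is positive because
  \<open>e \<alpha> \<le> r < j\<close>.\<close>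

lemma free_colon:
  assumes "i < Suc n" "j > r" "u \<in> FG n b e j" "sm (lin n (c i)) u \<in> vcombs n c (FG n b e) i (j + 1)"
  shows "u \<in> vcombs n c (FG n b e) i j"
  unfolding vcombs_FG_coord
proof (intro conjI allI)
  fix \<alpha>
  show "u \<alpha> \<in> form_combs n c i (j - e \<alpha>)"
  proof (cases "\<alpha> < b")
    case True
    have "lin n (c i) * u \<alpha> \<in> form_combs n c i (j - e \<alpha> + 1)"
      using assms(4) unfolding vcombs_FG_coord by (simp add: algebra_simps)
    then show ?thesis
      using assms(1-3) twist_bounds(2)[OF True] by - (rule reg, auto simp: FG_iff)
  next
    case False
    then show ?thesis using assms(3) by (simp add: FG_iff)
  qed
qed (fact assms(3))

lemma free_generated:
  assumes "j > r" "u \<in> FG n b e j"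
  shows "u \<in> vcombs n c (FG n b e) (Suc n) j"
  unfolding vcombs_FG_coord
proof (intro conjI allI)
  fix \<alpha>
  show "u \<alpha> \<in> form_combs n c (Suc n) (j - e \<alpha>)"
  proof (cases "\<alpha> < b")
    case True
    then show ?thesis
      using assms twist_bounds(2)[OF True] by - (rule gen, auto simp: FG_iff)
  next
    case False
    then show ?thesis using assms(2) by (simp add: FG_iff)
  qed
qed (fact assms(2))

text \<open>Write u = q + y_i g with q in Y_i F. Then y_i g lies in N + Y_i F, so g = p' + h' with
  p' in N and h' in Y_i F. Now u - y_i p' = q + y_i h' lies both in N and in Y_i F, where the
  induction hypothesis applies.\<close>

lemma submodule_combs:
  assumes "i \<le> Suc n" "j > r + 1" "u \<in> N" "u \<in> vcombs n c (FG n b e) i j"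
  shows "u \<in> vcombs n c NG i j"
  using assms
proof (induction i arbitrary: u)
  case 0
  then show ?case by (simp add: vcombs_def zero_fun_def)
next
  case (Suc i)
  let ?y = "lin n (c i)"
  obtain q g where q: "q \<in> vcombs n c (FG n b e) i j" and g: "g \<in> FG n b e (j - 1)" and u: "u = q + sm ?y g"
    using Suc.prems(4) unfolding vcombs_Suc by blast
  have "- q \<in> vcombs n c (FG n b e) i (j - 1 + 1)" using vcombs_FG_uminus[OF q] by simp
  moreover have "sm ?y g = u + - q" using u by simp
  \<comment> \<open>Injectivity is used in degree \<open>j - 1\<close>, which must exceed
    \<open>r\<close>; this is the source of the bound \<open>j > r + 1\<close>.\<close>
  ultimately obtain p' h' where p': "p' \<in> N" and h': "h' \<in> vcombs n c (FG n b e) i (j - 1)" and gp: "g = p' + h'"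
    using stage_colon[of i "j - 1" g u "- q"] Suc.prems g by auto
  have "p' = g - h'" using gp by simp
  then have p'F: "p' \<in> FG n b e (j - 1)" using g vcombs_FG[OF h'] FG_diff by blast
  have "sm ?y p' \<in> N" using graded_subD(4)[OF N homog_carrier[OF lin_homog] p'] .
  then have uN: "u - sm ?y p' \<in> N" using graded_sub_diff[OF N Suc.prems(3)] by blast
  have "u - sm ?y p' = q + sm ?y h'" using u gp by (simp add: sm_add)
  moreover have "sm ?y h' \<in> vcombs n c (FG n b e) i j" using vcombs_FG_sm[OF lin_homog h'] by simp
  ultimately have "u - sm ?y p' \<in> vcombs n c (FG n b e) i j" using vcombs_FG_add[OF q] by metis
  then have "u - sm ?y p' \<in> vcombs n c NG i j"
    by (rule Suc.IH[OF Suc_leD[OF Suc.prems(1)] Suc.prems(2) uN])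
  then show ?case unfolding vcombs_Suc
    using p' p'F by (intro bexI[of _ "u - sm ?y p'"] bexI[of _ p']) (auto simp: NG_def)
qed

text \<open>All of F lies in Y_{n+1} F above degree \<open>r\<close>, so
  \<open>submodule_combs\<close> applies with \<open>i = n + 1\<close>.\<close>

lemma submodule_generated: "j > r + 1 \<Longrightarrow> u \<in> NG j \<Longrightarrow> u \<in> vcombs n c NG (Suc n) j"
  using free_generated by (intro submodule_combs) (auto simp: NG_def)

text \<open>First \<open>u\<close> lies in Y_i F by injectivity for the free module, then in Y_i N
  by \<open>submodule_combs\<close>.\<close>

lemma submodule_colon:
  assumes "i < Suc n" "j > r + 1" "u \<in> NG j" "sm (lin n (c i)) u \<in> vcombs n c NG i (j + 1)"
  shows "u \<in> vcombs n c NG i j"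
proof (rule submodule_combs)
  have "sm (lin n (c i)) u \<in> vcombs n c (FG n b e) i (j + 1)"
    using assms(4) by (rule vcombs_mono) (auto simp: NG_def)
  then show "u \<in> vcombs n c (FG n b e) i j" using assms by - (rule free_colon, auto simp: NG_def)
qed (use assms in \<open>auto simp: NG_def\<close>)

text \<open>Take k-bases of N_0, ..., N_{r+1}. Negative degrees vanish since the twists are
  nonnegative, and degrees above \<open>r + 1\<close> follow inductively from
  \<open>submodule_generated\<close>.\<close>

lemma finite_generators:
  "\<exists>G. finite G \<and> (\<forall>g\<in>G. \<exists>j. 0 \<le> j \<and> j \<le> r + 1 \<and> g \<in> NG j) \<and> N \<subseteq> scomb n G"
proof -
  have "\<exists>B. finite B \<and> B \<subseteq> NG j \<and> NG j \<subseteq> vv.span B" for j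
  proof -
    obtain B where B: "B \<subseteq> NG j" "vv.independent B" "NG j \<subseteq> vv.span B"
      by (rule vv.maximal_independent_subset)
    obtain T :: "(nat \<Rightarrow> 'k mpoly) set" where T: "finite T" "FG n b e j \<subseteq> vv.span T"
      by (rule FG_finite_span)
    have "B \<subseteq> vv.span T" using B(1) T(2) unfolding NG_def by blast
    then have "finite B" using vv.independent_span_bound[OF T(1) B(2)] by blast
    with B show ?thesis by blast
  qed
  then obtain B where B: "\<And>j. finite (B j) \<and> B j \<subseteq> NG j \<and> NG j \<subseteq> vv.span (B j)" by metis
  define G where "G = (\<Union>j\<in>{0..r + 1}. B j)"
  have fin: "finite G" using B by (simp add: G_def)
  have low: "NG j \<subseteq> scomb n G" if "0 \<le> j" "j \<le> r + 1" for j
  proof -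
    have "B j \<subseteq> scomb n G" using that by (intro subsetI scomb_base fin) (auto simp: G_def)
    then have "vv.span (B j) \<subseteq> scomb n G" using scomb_span fin by blast
    with B show ?thesis by blast
  qed
  have neg: "NG j \<subseteq> scomb n G" if "j < 0" for j
  proof -
    have "u = 0" if "u \<in> NG j" for u
      using FG_neg[of u n b e j] that \<open>j < 0\<close> twist_bounds(1) by (force simp: NG_def)
    then show ?thesis by force
  qed
  have all: "NG (int k) \<subseteq> scomb n G" for k
  proof (induction k rule: less_induct)
    case (less k)
    show ?case
    proof (cases "int k \<le> r + 1")
      case False
      show ?thesis
      proof
        fix u assume "u \<in> NG (int k)"
        with False have "u \<in> vcombs n c NG (Suc n) (int k)" by (intro submodule_generated) auto
        then obtain f where f: "u = (\<Sum>a<Suc n. sm (lin n (c a)) (f a))" "\<forall>a<Suc n. f a \<in> NG (int k - 1)"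
          by (rule vcombsE)
        have "NG (int k - 1) \<subseteq> scomb n G"
        proof (cases k)
          case (Suc l)
          then show ?thesis using less[of l] by simp
        qed (simp add: neg)
        then show "u \<in> scomb n G"
          unfolding f(1) using f(2) by (intro scomb_sum scomb_sm homog_carrier[OF lin_homog]) auto
      qed
    qed (simp add: low)
  qed
  have NGall: "NG j \<subseteq> scomb n G" for j
    using all[of "nat j"] neg[of j] by (cases "j < 0") auto
  have "N \<subseteq> scomb n G"
  proof
    fix u assume u: "u \<in> N"
    then have uF: "u \<in> FM n b" using graded_subD(1)[OF N] by auto
    then obtain J where J: "u = (\<Sum>j\<in>J. vcomp e j u)" by (rule FM_decompose)
    have "vcomp e j u \<in> NG j" for j
      using vcomp_FG[OF uF] graded_subD(5)[OF N u] by (simp add: NG_def)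
    then have "(\<Sum>j\<in>J. vcomp e j u) \<in> scomb n G" using NGall by (intro scomb_sum) auto
    with J show "u \<in> scomb n G" by simp
  qed
  with fin B show ?thesis by (intro exI[of _ G]) (fastforce simp: G_def)
qed

text \<open>A generating set of least cardinality is irredundant. Irredundancy is what will make the
  resolution minimal.\<close>

lemma minimal_generators:
  "\<exists>G. finite G \<and> (\<forall>g\<in>G. \<exists>j. 0 \<le> j \<and> j \<le> r + 1 \<and> g \<in> NG j) \<and> N \<subseteq> scomb n G \<and>
    (\<forall>g\<in>G. g \<notin> scomb n (G - {g}))"
proof -
  define P where "P = (\<lambda>G. finite G \<and> (\<forall>g\<in>G. \<exists>j. 0 \<le> j \<and> j \<le> r + 1 \<and> g \<in> NG j) \<and> N \<subseteq> scomb n G)"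
  obtain G0 where "P G0" using finite_generators unfolding P_def by blast
  then obtain G where G: "P G" "\<And>H. P H \<Longrightarrow> card G \<le> card H"
    using ex_has_least_nat[of P G0 card] by blast
  have "g \<notin> scomb n (G - {g})" if g: "g \<in> G" for g
  proof
    assume a: "g \<in> scomb n (G - {g})"
    have fin: "finite G" using G by (simp add: P_def)
    have "scomb n G \<subseteq> scomb n (G - {g})"
    proof
      fix u assume "u \<in> scomb n G"
      then obtain q where q: "u = (\<Sum>h\<in>G. sm (q h) h)" "\<forall>h\<in>G. q h \<in> carrier (polyring n)"
        unfolding scomb_def by blast
      have "h \<in> scomb n (G - {g})" if "h \<in> G" for h
        using a that scomb_base[of "G - {g}" h] fin by (cases "h = g") auto
      then show "u \<in> scomb n (G - {g})"
        unfolding q(1) using q(2) by (intro scomb_sum scomb_sm) auto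
    qed
    then have "P (G - {g})" using G(1) by (auto simp: P_def)
    then have "card G \<le> card (G - {g})" by (rule G(2))
    then show False using card_Diff1_less[OF fin g] by simp
  qed
  with G(1) show ?thesis unfolding P_def by blast
qed

end

text \<open>The map \<open>\<phi>\<close> sends the basis of a free module F' to irredundant
  homogeneous generators of N, and N' is its kernel. As F'/N' is isomorphic to N, the injectivity
  required for F'/N' is \<open>submodule_colon\<close> for N.\<close>

theorem stage_step:
  assumes st: "stage r b e N"
  shows "\<exists>b' e' N' \<phi>. stage (r + 1) b' e' N' \<and>
    graded_hom n (free_module n b') (FG n b' e') (free_module n b) (FG n b e) \<phi> \<and>
    \<phi> ` FM n b' = N \<and> N' = {v \<in> FM n b'. \<phi> v = 0} \<and>
    (\<forall>v\<in>N'. \<forall>\<beta><b'. v \<beta> \<in> irrelevant_ideal n)"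
proof -
  note NGd = NG_def[OF st]
  note N = N[OF st]
  obtain G where G: "finite G" "\<forall>g\<in>G. \<exists>j. 0 \<le> j \<and> j \<le> r + 1 \<and> g \<in> NG b e N j" "N \<subseteq> scomb n G"
    "\<forall>g\<in>G. g \<notin> scomb n (G - {g})"
    using minimal_generators[OF st] by blast
  obtain dg where dg: "\<And>g. g \<in> G \<Longrightarrow> 0 \<le> dg g \<and> dg g \<le> r + 1 \<and> g \<in> NG b e N (dg g)"
    using G(2) by metis
  define b' where "b' = card G"
  obtain g where g: "bij_betw g {..<b'} G"
    using ex_bij_betw_nat_finite[OF G(1)] unfolding b'_def atLeast0LessThan by blast
  define e' where "e' = (\<lambda>\<beta>. dg (g \<beta>))"
  define \<phi> where "\<phi> = (\<lambda>v. \<Sum>\<beta><b'. sm (v \<beta>) (g \<beta>))"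
  define N' where "N' = {v \<in> FM n b'. \<phi> v = 0}"
  have gG: "g \<beta> \<in> G" if "\<beta> < b'" for \<beta> using g that by (auto simp: bij_betw_def)
  have gN: "g \<beta> \<in> N" and gF: "g \<beta> \<in> FG n b e (e' \<beta>)" and e': "0 \<le> e' \<beta>" "e' \<beta> \<le> r + 1" if "\<beta> < b'" for \<beta>
    using dg[OF gG[OF that]] by (auto simp: NGd e'_def)
  have \<phi>_add: "\<phi> (u + v) = \<phi> u + \<phi> v" for u v
    by (simp add: \<phi>_def sm_add_left sum.distrib)
  have \<phi>_sm: "\<phi> (sm p u) = sm p (\<phi> u)" for p u
    by (simp add: \<phi>_def sm_sum sm_mult)
  have \<phi>_0: "\<phi> 0 = 0" by (simp add: \<phi>_def)
  have \<phi>_diff: "\<phi> (u - v) = \<phi> u - \<phi> v" for u v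
    using \<phi>_add[of "u - v" v] by simp
  have \<phi>_sum: "\<phi> (sum f A) = (\<Sum>x\<in>A. \<phi> (f x))" for f :: "nat \<Rightarrow> nat \<Rightarrow> 'k mpoly" and A
    by (induction A rule: infinite_finite_induct) (simp_all only: sum.infinite sum.empty sum.insert not_False_eq_True \<phi>_add \<phi>_0)
  have \<phi>_N: "\<phi> v \<in> N" if "v \<in> FM n b'" for v
    unfolding \<phi>_def using that gN by (intro graded_sub_sum[OF N] graded_subD(4)[OF N]) (auto simp: FM_iff)
  have \<phi>_FG: "\<phi> v \<in> FG n b e j" if v: "v \<in> FG n b' e' j" for v j
  proof -
    have "sm (v \<beta>) (g \<beta>) \<in> FG n b e j" if "\<beta> < b'" for \<beta>
    proof -
      have "v \<beta> \<in> homog n (j - e' \<beta>)" using v by (simp add: FG_iff)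
      from FG_sm[OF this gF[OF that]] show ?thesis by simp
    qed
    then have "A \<subseteq> {..<b'} \<Longrightarrow> (\<Sum>\<beta>\<in>A. sm (v \<beta>) (g \<beta>)) \<in> FG n b e j" for A
      by (induction A rule: infinite_finite_induct) (auto intro: FG_add)
    then show ?thesis by (simp add: \<phi>_def)
  qed
  have \<phi>_NG: "\<phi> v \<in> NG b e N j" if "v \<in> FG n b' e' j" for v j
    using \<phi>_FG[OF that] \<phi>_N[OF FG_FM[OF that]] by (simp add: NGd)
  have \<phi>_vcomp: "\<phi> (vcomp e' j v) = vcomp e j (\<phi> v)" if v: "v \<in> FM n b'" for v j
  proof
    fix \<alpha>
    have "hcomp (j - e \<alpha>) (v \<beta> * g \<beta> \<alpha>) = hcomp (j - e' \<beta>) (v \<beta>) * g \<beta> \<alpha>" if "\<beta> < b'" for \<beta>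
      using hcomp_mult_homog[OF FM_coord[OF v], of "g \<beta> \<alpha>" "e' \<beta> - e \<alpha>"] gF[OF that] by (simp add: FG_iff)
    then show "\<phi> (vcomp e' j v) \<alpha> = vcomp e j (\<phi> v) \<alpha>"
      by (simp add: \<phi>_def sum_fun_apply vcomp_def hcomp_sum)
  qed
  have surj: "\<exists>v\<in>FM n b'. \<phi> v = u" if uN: "u \<in> N" for u
  proof -
    obtain q where q: "u = (\<Sum>h\<in>G. sm (q h) h)" "\<forall>h\<in>G. q h \<in> carrier (polyring n)"
      using subsetD[OF G(3) uN] unfolding scomb_def by blast
    let ?v = "\<lambda>\<beta>. if \<beta> < b' then q (g \<beta>) else 0"
    have "?v \<in> FM n b'" using q(2) gG by (auto simp: FM_iff)
    moreover have "\<phi> ?v = u"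
      unfolding q(1) \<phi>_def sum.reindex_bij_betw[OF g, symmetric] by (intro sum.cong) auto
    ultimately show ?thesis by blast
  qed
  \<comment> \<open>Homogeneous elements have homogeneous preimages: take the degree
    \<open>j\<close> component of any preimage, as \<open>\<phi>\<close> commutes with
    components.\<close>
  have surjG: "\<exists>v\<in>FG n b' e' j. \<phi> v = u" if u: "u \<in> NG b e N j" for u j
  proof -
    obtain v where v: "v \<in> FM n b'" "\<phi> v = u" using surj u by (auto simp: NGd)
    have "\<phi> (vcomp e' j v) = u"
      using \<phi>_vcomp[OF v(1)] v(2) vcomp_of_FG[of u n b e j j] u by (simp add: NGd)
    then show ?thesis using vcomp_FG[OF v(1)] by blast
  qed
  have N'g: "graded_sub n b' e' N'"
    unfolding graded_sub_def N'_def
  proof (intro conjI ballI allI)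
    fix v j assume v: "v \<in> {v \<in> FM n b'. \<phi> v = 0}"
    then have "\<phi> (vcomp e' j v) = 0" using \<phi>_vcomp[of v j] by (simp add: vcomp_def fun_eq_iff)
    then show "vcomp e' j v \<in> {v \<in> FM n b'. \<phi> v = 0}"
      using v vcomp_FG[of v n b' e' j] FG_FM by blast
  qed (auto simp: FM_add FM_sm \<phi>_0 \<phi>_add \<phi>_sm)
  \<comment> \<open>A relation with nonzero constant term at \<open>\<beta>\<close> would express
    \<open>g \<beta>\<close> through the other generators: take its component of degree
    \<open>e' \<beta>\<close> and scale the entry at \<open>\<beta>\<close> to -1.\<close>
  have min: "v \<beta> \<in> irrelevant_ideal n" if v: "v \<in> N'" and \<beta>: "\<beta> < b'" for v \<beta>
  proof -
    let ?a = "lookup (v \<beta>) 0"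
    have "?a = 0"
    proof (rule ccontr)
      assume a: "?a \<noteq> 0"
      define w where "w = sm (single 0 (- inverse ?a)) (vcomp e' (e' \<beta>) v)"
      let ?R = "\<Sum>\<gamma>\<in>{..<b'} - {\<beta>}. sm (w \<gamma>) (g \<gamma>)"
      have vF: "v \<in> FM n b'" using v by (simp add: N'_def)
      have w: "w \<in> N'"
        unfolding w_def using graded_subD(4)[OF N'g carrier_const graded_subD(5)[OF N'g v]] .
      then have wF: "w \<in> FM n b'" by (simp add: N'_def)
      have "hcomp 0 (v \<beta>) = single 0 (lookup (hcomp 0 (v \<beta>)) 0)"
        by (rule homog_0_const[OF hcomp_homog[OF FM_coord[OF vF]]])
      then have "hcomp 0 (v \<beta>) = single 0 ?a" by (simp add: lookup_hcomp)
      then have "w \<beta> = - 1" using a by (simp add: w_def vcomp_def mult_single single_uminus)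
      then have "sm (w \<beta>) (g \<beta>) = - g \<beta>" by (simp add: fun_eq_iff)
      moreover have "\<phi> w = sm (w \<beta>) (g \<beta>) + ?R"
        unfolding \<phi>_def using \<beta> by (intro sum.remove) auto
      moreover have "\<phi> w = 0" using w by (simp add: N'_def)
      ultimately have "- g \<beta> + ?R = 0" by metis
      then have eq: "?R = g \<beta>" by (simp only: add_eq_0_iff minus_minus)
      have "(\<Sum>\<gamma>\<in>{..<b'} - {\<beta>}. sm (w \<gamma>) (g \<gamma>)) \<in> scomb n (G - {g \<beta>})"
      proof (intro scomb_sum scomb_sm scomb_base)
        fix \<gamma> assume \<gamma>: "\<gamma> \<in> {..<b'} - {\<beta>}"
        then have "g \<gamma> \<noteq> g \<beta>" using g \<beta> by (auto simp: bij_betw_def inj_on_def)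
        then show "g \<gamma> \<in> G - {g \<beta>}" using gG \<gamma> by simp
        show "w \<gamma> \<in> carrier (polyring n)" using FM_coord[OF wF] .
      qed (use G in auto)
      then show False unfolding eq using G(4) gG[OF \<beta>] by blast
    qed
    then show ?thesis using FM_coord[of v n b' \<beta>] v by (simp add: irrelevant_ideal_def N'_def)
  qed
  have stage': "stage (r + 1) b' e' N'"
    unfolding stage_def
  proof (intro conjI allI impI ballI)
    fix i j u p h
    assume i: "i < Suc n" and j: "r + 1 < j" and u: "u \<in> FG n b' e' j" and p: "p \<in> N'"
      and h: "h \<in> vcombs n c (FG n b' e') i (j + 1)" and eq: "sm (lin n (c i)) u = p + h"
    obtain f where f: "h = (\<Sum>a<i. sm (lin n (c a)) (f a))" "\<forall>a<i. f a \<in> FG n b' e' (j + 1 - 1)"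
      using h by (rule vcombsE)
    have "sm (lin n (c i)) (\<phi> u) = \<phi> h"
      using p arg_cong[OF eq, of \<phi>] by (simp add: \<phi>_sm \<phi>_add N'_def)
    also have "\<dots> = (\<Sum>a<i. sm (lin n (c a)) (\<phi> (f a)))" by (simp add: f(1) \<phi>_sum \<phi>_sm)
    also have "\<dots> \<in> vcombs n c (NG b e N) i (j + 1)"
      using f(2) \<phi>_NG by (intro vcombsI) simp
    finally have "\<phi> u \<in> vcombs n c (NG b e N) i j"
      by (rule submodule_colon[OF st i j \<phi>_NG[OF u]])
    \<comment> \<open>Lifting the coefficients \<open>f a\<close> to F' gives an element of Y_i F'
      with the same image as \<open>u\<close>; the difference lies in the kernel N'.\<close>
    then obtain f where f: "\<phi> u = (\<Sum>a<i. sm (lin n (c a)) (f a))" "\<forall>a<i. f a \<in> NG b e N (j - 1)"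
      by (rule vcombsE)
    have "\<forall>a\<in>{..<i}. \<exists>v. v \<in> FG n b' e' (j - 1) \<and> \<phi> v = f a"
      using surjG f(2) by blast
    from bchoice[OF this] obtain w where w: "\<And>a. a < i \<Longrightarrow> w a \<in> FG n b' e' (j - 1) \<and> \<phi> (w a) = f a"
      by blast
    let ?h = "\<Sum>a<i. sm (lin n (c a)) (w a)"
    have h': "?h \<in> vcombs n c (FG n b' e') i j" using w by (intro vcombsI) simp
    have "\<phi> ?h = \<phi> u" using w by (simp add: f(1) \<phi>_sum \<phi>_sm)
    moreover have "u - ?h \<in> FM n b'" using FG_FM[OF FG_diff[OF u vcombs_FG[OF h']]] .
    ultimately have "u - ?h \<in> N'" by (simp add: N'_def \<phi>_diff)
    then show "\<exists>p'\<in>N'. \<exists>h'\<in>vcombs n c (FG n b' e') i j. u = p' + h'"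
      using h' by (intro bexI[of _ "u - ?h"] bexI[of _ ?h]) auto
  qed (use N'g e' in auto)
  have "graded_hom n (free_module n b') (FG n b' e') (free_module n b) (FG n b e) \<phi>"
    unfolding graded_hom_def
  proof (intro conjI ballI allI)
    show "\<phi> \<in> FM n b' \<rightarrow> FM n b" using \<phi>_N graded_subD(1)[OF N] by blast
    show "\<phi> ` FG n b' e' j \<subseteq> FG n b e j" for j using \<phi>_FG by blast
  qed (use \<phi>_add \<phi>_sm in \<open>auto simp: free_module_def plus_fun_def sm_def\<close>)
  moreover have "\<phi> ` FM n b' = N" using surj \<phi>_N by blast
  ultimately show ?thesis using stage' min N'_def by blast
qed

end

subsection \<open>Polynomials vanishing everywhere\<close>

lemma monom_val_upd: "x \<notin> keys m \<Longrightarrow> monom_val (v(x := t)) m = monom_val v m"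
  unfolding monom_val_def by (intro prod.cong) auto

lemma monom_val_single: "monom_val v (single x k) = v x ^ k"
  by (simp add: monom_val_def)

lemma exponent_split:
  fixes m :: "nat \<Rightarrow>\<^sub>0 nat"
  shows "m = (m - single x (lookup m x)) + single x (lookup m x)"
  by (rule poly_mapping_eqI) (simp add: lookup_add lookup_minus lookup_single when_def)

lemma keys_exponent_split:
  fixes m :: "nat \<Rightarrow>\<^sub>0 nat"
  shows "keys (m - single x (lookup m x)) = keys m - {x}"
  by (auto simp: in_keys_iff lookup_minus lookup_single when_def split: if_splits)

text \<open>Induction on the set of variables. As a polynomial in the variable \<open>x\<close> with
  coefficients \<open>q k\<close> free of \<open>x\<close>, \<open>p\<close> vanishes for every
  value of \<open>x\<close>, so each \<open>q k\<close> vanishes at every point.\<close>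

lemma poly_eq_0_if_vanishing:
  fixes p :: "'k::field mpoly"
  assumes inf: "infinite (UNIV :: 'k set)" and "finite A" "\<And>m. m \<in> keys p \<Longrightarrow> keys m \<subseteq> A" "\<And>v. eval_poly v p = 0"
  shows "p = 0"
  using assms(2-)
proof (induction A arbitrary: p rule: finite_induct)
  case empty
  have "m = 0" if "m \<in> keys p" for m
    using empty(1)[OF that] by (intro poly_mapping_eqI) (auto simp: in_keys_iff)
  then have "keys p \<subseteq> {0}" by blast
  then have p: "p = single 0 (lookup p 0)"
    by (intro poly_mapping_eqI) (auto simp: lookup_single when_def in_keys_iff)
  have "eval_poly (\<lambda>_. 0) (single 0 (lookup p 0)) = 0" using empty(2) p by metis
  then have "lookup p 0 = 0" by (simp add: monom_val_def)
  then show ?case using p by simp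
next
  case (insert x A)
  define q where "q = (\<lambda>k. \<Sum>m\<in>{m \<in> keys p. lookup m x = k}. single (m - single x k) (lookup p m))"
  have "q k = 0" for k
  proof (rule insert.IH)
    fix m assume "m \<in> keys (q k)"
    then have "(\<Sum>m'\<in>{m \<in> keys p. lookup m x = k}. lookup (single (m' - single x k) (lookup p m')) m) \<noteq> 0"
      by (simp add: in_keys_iff q_def lookup_sum)
    then obtain m' where m': "m' \<in> keys p" "lookup m' x = k" "lookup (single (m' - single x k) (lookup p m')) m \<noteq> 0"
      by (metis (mono_tags, lifting) mem_Collect_eq sum.neutral)
    then have "m = m' - single x (lookup m' x)" by (simp add: lookup_single when_def split: if_splits)
    then show "keys m \<subseteq> A" using insert.prems(1)[OF m'(1)] by (auto simp: keys_exponent_split)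
  next
    fix v
    define P where "P = (\<Sum>m\<in>keys p. Polynomial.monom (lookup p m * monom_val v (m - single x (lookup m x))) (lookup m x))"
    have "poly P t = eval_poly (v(x := t)) p" for t
    proof -
      have "monom_val (v(x := t)) m = monom_val v (m - single x (lookup m x)) * t ^ lookup m x" for m
        using monom_val_add[of "v(x := t)" "m - single x (lookup m x)" "single x (lookup m x)"]
        by (simp add: exponent_split[symmetric] monom_val_single monom_val_upd keys_exponent_split)
      then show ?thesis by (simp add: P_def poly_sum poly_monom eval_poly_alt algebra_simps)
    qed
    then have "{t. poly P t = 0} = UNIV" using insert.prems(2) by simp
    then have "P = 0" using poly_roots_finite[of P] inf by metis
    then have "0 = Polynomial.coeff P k" by simp
    also have "\<dots> = (\<Sum>m\<in>keys p. if lookup m x = k then lookup p m * monom_val v (m - single x (lookup m x)) else 0)"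
      by (simp add: P_def coeff_sum if_distrib cong: if_cong)
    also have "\<dots> = (\<Sum>m\<in>{m \<in> keys p. lookup m x = k}. lookup p m * monom_val v (m - single x k))"
      by (simp add: sum.If_cases Int_def)
    also have "\<dots> = eval_poly v (q k)"
      by (simp add: q_def eval_sum)
    finally show "eval_poly v (q k) = 0" by simp
  qed
  show ?case
  proof (rule poly_mapping_eqI)
    fix m
    show "lookup p m = lookup 0 m"
    proof (rule ccontr)
      assume "lookup p m \<noteq> lookup 0 m"
      then have m: "m \<in> keys p" by (simp add: in_keys_iff)
      define k where "k = lookup m x"
      \<comment> \<open>Among monomials with exponent \<open>k\<close> at \<open>x\<close>, removing
        that power is injective, so no two terms of \<open>p\<close> merge in
        \<open>q k\<close>.\<close>
      have inj: "m' - single x k = m - single x k \<longleftrightarrow> m' = m" if "lookup m' x = k" for m' :: "nat \<Rightarrow>\<^sub>0 nat"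
        using exponent_split[of m x] exponent_split[of m' x] that unfolding k_def by metis
      have "lookup (q k) (m - single x k) =
          (\<Sum>m'\<in>{m \<in> keys p. lookup m x = k}. if m' = m then lookup p m' else 0)"
        unfolding q_def lookup_sum by (intro sum.cong) (auto simp: lookup_single when_def inj)
      also have "\<dots> = lookup p m" using m by (simp add: k_def)
      finally show False using \<open>q k = 0\<close> m by (simp add: in_keys_iff)
    qed
  qed
qed

lemma eval_cong_coords:
  assumes "p \<in> carrier (polyring n)" "\<And>i. i \<le> n \<Longrightarrow> v i = w i"
  shows "eval_poly v p = eval_poly w p"
proof -
  have "monom_val v m = monom_val w m" if "m \<in> keys p" for m
  proof -
    have "v i = w i" if "i \<in> keys m" for i
      using assms that \<open>m \<in> keys p\<close> by (auto simp: polyring_carrier_iff)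
    then show ?thesis by (simp add: monom_val_def)
  qed
  then show ?thesis by (simp add: eval_poly_alt)
qed

text \<open>Makes the whole coordinate space an arrangement with ideal 0, which brings S itself
  under \<open>colon_ideal\<close>.\<close>

lemma vanish_coord_space:
  assumes "infinite (UNIV :: 'k::field set)" "u \<in> vanish n (coord_space n :: (nat \<Rightarrow> 'k) set) j"
  shows "u = 0"
proof (rule poly_eq_0_if_vanishing[OF assms(1), of "{..n}"])
  have u: "u \<in> carrier (polyring n)" using assms(2) homog_carrier by (auto simp: vanish_def)
  show "keys m \<subseteq> {..n}" if "m \<in> keys u" for m using u that by (simp add: polyring_carrier_iff)
  fix v :: "nat \<Rightarrow> 'k"
  have "eval_poly v u = eval_poly (\<lambda>i. if i \<le> n then v i else 0) u"
    by (rule eval_cong_coords[OF u]) simp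
  also have "\<dots> = 0" using assms(2) by (simp add: vanish_def coord_space_def)
  finally show "eval_poly v u = 0" .
qed simp

subsection \<open>Homogeneous ideals as graded modules\<close>

lemma polyring_simps [simp]:
  "x \<otimes>\<^bsub>polyring n\<^esub> y = x * y" "x \<oplus>\<^bsub>polyring n\<^esub> y = x + y"
  "\<one>\<^bsub>polyring n\<^esub> = 1" "\<zero>\<^bsub>polyring n\<^esub> = 0"
  by (simp_all add: polyring_def)

lemma poly_carrier_1 [simp]: "1 \<in> carrier (polyring n)"
  by (simp add: polyring_carrier_iff)

lemma cring_polyring: "cring (polyring n :: 'k::field mpoly ring)"
proof (rule cringI)
  show "abelian_group (polyring n :: 'k mpoly ring)"
  proof (rule abelian_groupI)
    fix x :: "'k mpoly" assume "x \<in> carrier (polyring n)"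
    then show "\<exists>y\<in>carrier (polyring n). y \<oplus>\<^bsub>polyring n\<^esub> x = \<zero>\<^bsub>polyring n\<^esub>"
      using poly_carrier_uminus[of x n] by (intro bexI[of _ "- x"]) simp_all
  qed (auto simp: poly_carrier_add algebra_simps)
  show "Group.comm_monoid (polyring n :: 'k mpoly ring)"
    by (rule comm_monoidI) (auto simp: poly_carrier_mult algebra_simps)
qed (auto simp: algebra_simps)

definition homog_ideal :: "nat \<Rightarrow> 'k::field mpoly set \<Rightarrow> bool" where
  "homog_ideal n I \<longleftrightarrow> I \<subseteq> carrier (polyring n) \<and> 0 \<in> I \<and> (\<forall>p\<in>I. \<forall>q\<in>I. p + q \<in> I) \<and>
    (\<forall>a\<in>carrier (polyring n). \<forall>p\<in>I. a * p \<in> I) \<and> (\<forall>p\<in>I. \<forall>j. hcomp j p \<in> I)"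

context
  fixes n :: nat and I :: "'k::field mpoly set"
  assumes I: "homog_ideal n I"
begin

lemma homog_idealD:
  "p \<in> I \<Longrightarrow> p \<in> carrier (polyring n)" "0 \<in> I" "p \<in> I \<Longrightarrow> q \<in> I \<Longrightarrow> p + q \<in> I"
  "a \<in> carrier (polyring n) \<Longrightarrow> p \<in> I \<Longrightarrow> a * p \<in> I" "p \<in> I \<Longrightarrow> hcomp j p \<in> I"
  using I by (auto simp: homog_ideal_def)

lemma homog_ideal_uminus: "p \<in> I \<Longrightarrow> - p \<in> I"
  using homog_idealD(4)[OF carrier_const[of "- 1"], of p] by (simp add: single_uminus)

lemma abelian_group_ideal_module: "abelian_group (ideal_module n I)"
proof (rule abelian_groupI)
  fix x assume "x \<in> carrier (ideal_module n I)"
  then show "\<exists>y\<in>carrier (ideal_module n I). y \<oplus>\<^bsub>ideal_module n I\<^esub> x = \<zero>\<^bsub>ideal_module n I\<^esub>"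
    using homog_ideal_uminus[of x] by (intro bexI[of _ "- x"]) (simp_all add: ideal_module_def)
qed (use homog_idealD in \<open>auto simp: ideal_module_def algebra_simps\<close>)

lemma module_ideal_module: "Module.module (polyring n) (ideal_module n I)"
  by (rule moduleI[OF cring_polyring abelian_group_ideal_module])
     (use homog_idealD in \<open>auto simp: ideal_module_def algebra_simps\<close>)

lemma ideal_polyring: "ideal I (polyring n)"
proof (rule idealI)
  show ring: "ring (polyring n)" using cring_polyring cring.axioms(1) by blast
  have grp: "abelian_group (polyring n)" using ring ring.is_abelian_group by blast
  show "subgroup I (add_monoid (polyring n))"
  proof
    fix x assume x: "x \<in> I"
    have "\<ominus>\<^bsub>polyring n\<^esub> x = - x"
      using x homog_idealD(1)[OF x] poly_carrier_uminus
      by (intro abelian_group.minus_equality[OF grp]) auto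
    then show "inv\<^bsub>add_monoid (polyring n)\<^esub> x \<in> I"
      using homog_ideal_uminus[OF x] by (simp add: a_inv_def)
  qed (use homog_idealD in auto)
  show "a \<otimes>\<^bsub>polyring n\<^esub> x \<in> I" if "a \<in> I" "x \<in> carrier (polyring n)" for a x
    using homog_idealD(4)[OF that(2,1)] by (simp add: mult.commute)
qed (simp add: homog_idealD)

lemma finsum_ideal_module:
  assumes "finite A" "\<And>j. j \<in> A \<Longrightarrow> c j \<in> I"
  shows "(\<Oplus>\<^bsub>ideal_module n I\<^esub>j\<in>A. c j) = (\<Sum>j\<in>A. c j)"
proof -
  interpret M: abelian_group "ideal_module n I" by (rule abelian_group_ideal_module)
  show ?thesis using assms
  proof (induction A rule: finite_induct)
    case (insert x F)
    then have "(\<Oplus>\<^bsub>ideal_module n I\<^esub>j\<in>insert x F. c j) = c x + (\<Oplus>\<^bsub>ideal_module n I\<^esub>j\<in>F. c j)"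
      using M.finsum_insert[of F x c] by (auto simp: ideal_module_def)
    with insert show ?case by simp
  next
    case empty
    show ?case unfolding M.finsum_empty by (simp add: ideal_module_def)
  qed
qed

lemma additive_subgroup_homog: "additive_subgroup (I \<inter> homog n j) (ideal_module n I)"
proof (rule additive_subgroupI)
  show "subgroup (I \<inter> homog n j) (add_monoid (ideal_module n I))"
  proof
    fix x assume x: "x \<in> I \<inter> homog n j"
    have "\<ominus>\<^bsub>ideal_module n I\<^esub> x = - x"
      using x homog_ideal_uminus
      by (intro abelian_group.minus_equality[OF abelian_group_ideal_module]) (auto simp: ideal_module_def)
    then show "inv\<^bsub>add_monoid (ideal_module n I)\<^esub> x \<in> I \<inter> homog n j"
      using x homog_ideal_uminus[of x] homog_uminus[of x n j] by (simp add: a_inv_def)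
  qed (use homog_idealD homog_add in \<open>auto simp: ideal_module_def\<close>)
qed

text \<open>The homogeneous components give existence. For uniqueness, \<open>hcomp j\<close>
  applied to any decomposition isolates its term of degree \<open>j\<close>.\<close>

lemma homog_decomposition_unique:
  assumes x: "x \<in> I"
  shows "\<exists>!c. (\<forall>j. c j \<in> I \<inter> homog n j) \<and> finite {j. c j \<noteq> \<zero>\<^bsub>ideal_module n I\<^esub>} \<and>
      x = (\<Oplus>\<^bsub>ideal_module n I\<^esub>j\<in>{j. c j \<noteq> \<zero>\<^bsub>ideal_module n I\<^esub>}. c j)"
proof -
  have z: "\<zero>\<^bsub>ideal_module n I\<^esub> = 0" by (simp add: ideal_module_def)
  show ?thesis unfolding z
  proof (rule ex1I)
    let ?J = "{j. hcomp j x \<noteq> 0}"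
    have J: "?J \<subseteq> degrees x" using hcomp_notin_degrees by blast
    then have fin: "finite ?J" by (rule finite_subset) simp
    have "x = (\<Sum>j\<in>degrees x. hcomp j x)" by (simp add: sum_hcomp_degrees)
    also have "\<dots> = (\<Sum>j\<in>?J. hcomp j x)" using J by (intro sum.mono_neutral_right) auto
    also have "\<dots> = (\<Oplus>\<^bsub>ideal_module n I\<^esub>j\<in>?J. hcomp j x)"
      using fin homog_idealD(5)[OF x] by (intro finsum_ideal_module[symmetric]) auto
    finally show "(\<forall>j. hcomp j x \<in> I \<inter> homog n j) \<and> finite ?J \<and> x = (\<Oplus>\<^bsub>ideal_module n I\<^esub>j\<in>?J. hcomp j x)"
      using fin homog_idealD(5)[OF x] hcomp_homog[OF homog_idealD(1)[OF x]] by blast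
  next
    fix c assume c: "(\<forall>j. c j \<in> I \<inter> homog n j) \<and> finite {j. c j \<noteq> 0} \<and>
        x = (\<Oplus>\<^bsub>ideal_module n I\<^esub>j\<in>{j. c j \<noteq> 0}. c j)"
    then have xs: "x = (\<Sum>j\<in>{j. c j \<noteq> 0}. c j)"
      using finsum_ideal_module[of "{j. c j \<noteq> 0}" c] by auto
    show "c = (\<lambda>j. hcomp j x)"
    proof
      fix j
      have "hcomp j x = (\<Sum>i\<in>{i. c i \<noteq> 0}. hcomp j (c i))"
        by (subst xs) (rule hcomp_sum)
      also have "\<dots> = (\<Sum>i\<in>{i. c i \<noteq> 0}. if i = j then c i else 0)"
        using c by (intro sum.cong) (auto simp: hcomp_of_homog[of _ n])
      also have "\<dots> = c j" using c by auto
      finally show "c j = hcomp j x" ..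
    qed
  qed
qed

lemma graded_module_ideal: "graded_module n (ideal_module n I) (\<lambda>j. I \<inter> homog n j)"
  unfolding graded_module_def
proof (intro conjI allI ballI)
  fix i j and a x :: "'k mpoly" assume "a \<in> homog n i" "x \<in> I \<inter> homog n j"
  then show "a \<odot>\<^bsub>ideal_module n I\<^esub> x \<in> I \<inter> homog n (i + j)"
    using homog_idealD(4)[OF homog_carrier] by (simp add: ideal_module_def homog_mult)
next
  fix x assume "x \<in> carrier (ideal_module n I)"
  then have "x \<in> I" by (simp add: ideal_module_def)
  then show "\<exists>!c. (\<forall>j. c j \<in> I \<inter> homog n j) \<and> finite {j. c j \<noteq> \<zero>\<^bsub>ideal_module n I\<^esub>} \<and>
      x = (\<Oplus>\<^bsub>ideal_module n I\<^esub>j\<in>{j. c j \<noteq> \<zero>\<^bsub>ideal_module n I\<^esub>}. c j)"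
    by (rule homog_decomposition_unique)
qed (rule module_ideal_module additive_subgroup_homog)+

end

section \<open>Ideals and generic forms of an arrangement\<close>

lemma hcomp_vanish:
  fixes p :: "'k::field mpoly"
  assumes inf: "infinite (UNIV :: 'k set)" and p: "p \<in> carrier (polyring n)"
    and v: "\<And>t. eval_poly (\<lambda>i. t * v i) p = 0"
  shows "eval_poly v (hcomp j p) = 0"
proof (cases "j \<in> degrees p")
  case True
  \<comment> \<open>This is p(tv) as a polynomial in t. Its coefficient at t^j is the value at
    \<open>v\<close> of the degree \<open>j\<close> component, and it is zero because it vanishes on
    an infinite field.\<close>
  define P where "P = (\<Sum>j\<in>degrees p. Polynomial.monom (eval_poly v (hcomp j p)) (nat j))"
  have "poly P t = eval_poly (\<lambda>i. t * v i) p" for t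
  proof -
    have "eval_poly (\<lambda>i. t * v i) p = (\<Sum>j\<in>degrees p. eval_poly (\<lambda>i. t * v i) (hcomp j p))"
      by (subst sum_hcomp_degrees[symmetric, of "degrees p" p]) (simp_all add: eval_sum)
    also have "\<dots> = (\<Sum>j\<in>degrees p. t ^ nat j * eval_poly v (hcomp j p))"
      by (intro sum.cong refl eval_homog_scale[OF hcomp_homog[OF p]])
    finally show ?thesis by (simp add: P_def poly_sum poly_monom mult.commute)
  qed
  then have "{t. poly P t = 0} = UNIV" using v by simp
  then have "P = 0" using poly_roots_finite[of P] inf by metis
  then have "0 = Polynomial.coeff P (nat j)" by simp
  also have "\<dots> = (\<Sum>k\<in>degrees p. if k = j then eval_poly v (hcomp k p) else 0)"
    unfolding P_def coeff_sum using True by (intro sum.cong) (auto simp: degrees_def)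
  also have "\<dots> = eval_poly v (hcomp j p)" using True by simp
  finally show ?thesis by simp
qed (simp add: hcomp_notin_degrees)

text \<open>Cones are stable under scaling, so \<open>hcomp_vanish\<close> applies. Nonemptiness of
  \<open>A\<close> keeps the intersection inside the carrier.\<close>

lemma homog_ideal_arrangement:
  fixes V :: "'i \<Rightarrow> (nat \<Rightarrow> 'k::field) set"
  assumes inf: "infinite (UNIV :: 'k set)" and V: "\<And>a. a \<in> A \<Longrightarrow> linear_space n (V a)" and A: "A \<noteq> {}"
  shows "homog_ideal n (\<Inter>a\<in>A. vanishing_ideal n (V a))"
  unfolding homog_ideal_def
proof (intro conjI ballI allI)
  show "(\<Inter>a\<in>A. vanishing_ideal n (V a)) \<subseteq> carrier (polyring n)"
    using A by (auto simp: vanishing_ideal_def)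
  fix p j assume p: "p \<in> (\<Inter>a\<in>A. vanishing_ideal n (V a))"
  have pc: "p \<in> carrier (polyring n)" using p A by (auto simp: vanishing_ideal_def)
  have "eval_poly v (hcomp j p) = 0" if "a \<in> A" "v \<in> V a" for a v
    using p that linear_space_scale[OF V] by (intro hcomp_vanish[OF inf pc]) (auto simp: vanishing_ideal_def)
  then show "hcomp j p \<in> (\<Inter>a\<in>A. vanishing_ideal n (V a))"
    using homog_carrier[OF hcomp_homog[OF pc]] by (auto simp: vanishing_ideal_def)
qed (auto simp: vanishing_ideal_def eval_add eval_mult poly_carrier_add poly_carrier_mult)

lemma vanishing_ideal_homog:
  assumes "A \<noteq> {}"
  shows "(\<Inter>a\<in>A. vanishing_ideal n (V a)) \<inter> homog n j = vanish n (\<Union>a\<in>A. V a) j"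
  using assms by (auto simp: vanishing_ideal_def vanish_def homog_carrier)

lemma linear_space_coord_space: "linear_space n (coord_space n)"
  using subspace_coord_space by (simp add: linear_space_def coord_space_def)

text \<open>\<open>generic_moment_forms\<close> is applied to the finitely many intersections of
  subfamilies of \<open>D\<close>.\<close>

lemma exists_generic_forms:
  fixes V :: "'i \<Rightarrow> (nat \<Rightarrow> 'k::field) set"
  assumes inf: "infinite (UNIV :: 'k set)" and D: "finite D" and V: "\<And>a. a \<in> D \<Longrightarrow> linear_space n (V a)"
  shows "\<exists>c. generic_forms n D V c"
proof -
  define W where "W = (\<lambda>A. {z \<in> coord_space n. \<forall>a\<in>A. z \<in> V a})"
  have W: "finite (W ` Pow D)" "\<And>X. X \<in> W ` Pow D \<Longrightarrow> X \<subseteq> coord_space n"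
    using D by (auto simp: W_def)
  obtain t :: "nat \<Rightarrow> 'k" where t: "inj t"
    "\<forall>i. \<forall>X\<in>W ` Pow D. (\<exists>v\<in>X. v \<noteq> 0 \<and> (\<forall>a<i. dot n (moment_form n (t a)) v = 0)) \<longrightarrow>
      (\<exists>v\<in>X. (\<forall>a<i. dot n (moment_form n (t a)) v = 0) \<and> dot n (moment_form n (t i)) v \<noteq> 0)"
    using generic_moment_forms[OF inf W] by blast
  have "generic_forms n D V (\<lambda>i. moment_form n (t i))"
  proof
    show "z = 0" if "z \<in> coord_space n" "\<And>b. b < Suc n \<Longrightarrow> dot n (moment_form n (t b)) z = 0" for z
      using moment_forms_independent[OF that(1) t(1)] that(2) by blast
    fix A i z
    assume A: "A \<subseteq> D" and "z \<in> coord_space n" "z \<noteq> 0" "\<And>a. a \<in> A \<Longrightarrow> z \<in> V a"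
      "\<And>b. b < i \<Longrightarrow> dot n (moment_form n (t b)) z = 0"
    then have "\<exists>v\<in>W A. v \<noteq> 0 \<and> (\<forall>a<i. dot n (moment_form n (t a)) v = 0)"
      by (intro bexI[of _ z]) (auto simp: W_def)
    then have "\<exists>v\<in>W A. (\<forall>a<i. dot n (moment_form n (t a)) v = 0) \<and> dot n (moment_form n (t i)) v \<noteq> 0"
      using t(2) A by blast
    then show "\<exists>z\<in>coord_space n. (\<forall>a\<in>A. z \<in> V a) \<and> (\<forall>b<i. dot n (moment_form n (t b)) z = 0) \<and>
        dot n (moment_form n (t i)) z \<noteq> 0"
      by (auto simp: W_def)
  qed (use inf V moment_form_coord in auto)
  then show ?thesis by blast
qed

subsection \<open>Regularity of the arrangement\<close>

lemma (in generic_forms) linear_forms_seq: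
  assumes a: "a \<in> D" "V a = coord_space n"
  shows "linear_forms_seq n c"
proof -
  have forms: "u \<in> form_combs n c i j" if u: "u \<in> IY {a} i j" for u i j
  proof -
    obtain p h where ph: "p \<in> vanish n (coord_space n) j" "h \<in> form_combs n c i j" "u = p + h"
      using u a(2) unfolding ideal_plus_def by auto
    then show ?thesis using vanish_coord_space[OF inf ph(1)] by simp
  qed
  show ?thesis
  proof
    fix i j and u :: "'k mpoly"
    assume *: "i < Suc n" "1 \<le> j" "u \<in> homog n j" "y i * u \<in> form_combs n c i (j + 1)"
    show "u \<in> form_combs n c i j"
      by (rule forms, rule colon_ideal[OF _ _ *(1) _ *(3) ideal_plus_forms[OF *(4)]]) (use * a in auto)
  next
    fix j and u :: "'k mpoly" assume "1 \<le> j" "u \<in> homog n j"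
    then show "u \<in> form_combs n c (Suc n) j" by (intro forms homog_pos_generated)
  qed
qed

text \<open>The ideal as a submodule of the free module of rank one, so that a \<open>stage\<close>
  with F = S describes M = S/I.\<close>

definition coord_module :: "'k::field mpoly set \<Rightarrow> (nat \<Rightarrow> 'k mpoly) set" where
  "coord_module I = {v. v 0 \<in> I \<and> (\<forall>\<alpha>\<ge>1. v \<alpha> = 0)}"

definition embed :: "'k::field mpoly \<Rightarrow> nat \<Rightarrow> 'k mpoly" where
  "embed p = (\<lambda>\<alpha>. if \<alpha> = 0 then p else 0)"

lemma embed_coord_module: "p \<in> I \<Longrightarrow> embed p \<in> coord_module I"
  by (simp add: embed_def coord_module_def)

lemma FG_rank_one: "v \<in> FG n 1 (\<lambda>_. 0) j \<longleftrightarrow> v 0 \<in> homog n j \<and> (\<forall>\<alpha>\<ge>1. v \<alpha> = 0)"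
proof -
  have "v \<alpha> \<in> homog n j" if "v 0 \<in> homog n j" "\<forall>\<alpha>\<ge>1. v \<alpha> = 0" for \<alpha>
    using that by (cases "\<alpha> = 0") auto
  then show ?thesis by (auto simp: FG_iff)
qed

lemma graded_sub_coord_module:
  assumes I: "homog_ideal n I"
  shows "graded_sub n 1 (\<lambda>_. 0) (coord_module I)"
  unfolding graded_sub_def
proof (intro conjI ballI allI)
  show "coord_module I \<subseteq> FM n 1"
    using homog_idealD(1)[OF I] by (auto simp: coord_module_def FM_iff)
qed (use homog_idealD[OF I] in \<open>auto simp: coord_module_def vcomp_def\<close>)

text \<open>Translates \<open>colon_ideal\<close> into the language of \<open>stage\<close>: the
  strict bound \<open>j > card A - 1\<close> is \<open>card A \<le> j\<close>.\<close>

lemma (in generic_forms) stage_arrangement: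
  assumes a0: "a0 \<in> D" "V a0 = coord_space n" and A: "A \<subseteq> D" "finite A" "A \<noteq> {}"
  shows "linear_forms_seq.stage n c (int (card A) - 1) 1 (\<lambda>_. 0) (coord_module (\<Inter>a\<in>A. vanishing_ideal n (V a)))"
proof -
  let ?I = "\<Inter>a\<in>A. vanishing_ideal n (V a)"
  interpret S: linear_forms_seq n c using linear_forms_seq[OF a0] .
  have I: "homog_ideal n ?I"
    using A V by (intro homog_ideal_arrangement[OF inf]) auto
  have card: "card A \<ge> 1" using A by (simp add: Suc_le_eq card_gt_0_iff)
  show ?thesis
    unfolding S.stage_def
  proof (intro conjI allI impI ballI)
    show "graded_sub n 1 (\<lambda>_. 0) (coord_module ?I)" using graded_sub_coord_module[OF I] .
    fix i j u p h
    assume i: "i < Suc n" and j: "int (card A) - 1 < j" and u: "u \<in> FG n 1 (\<lambda>_. 0) j"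
      and p: "p \<in> coord_module ?I" and h: "h \<in> vcombs n c (FG n 1 (\<lambda>_. 0)) i (j + 1)"
      and eq: "sm (y i) u = p + h"
    have h0: "h 0 \<in> form_combs n c i (j + 1)" using h unfolding vcombs_FG_coord by simp
    have u0: "u 0 \<in> homog n j" using u unfolding FG_rank_one by simp
    have eq0: "y i * u 0 = p 0 + h 0" using arg_cong[OF eq, of "\<lambda>v. v 0"] by simp
    \<comment> \<open>Membership of \<open>p\<close> in the submodule does not fix a degree;
      homogeneity of \<open>p 0\<close> is read off from the other two terms.\<close>
    have "p 0 = y i * u 0 - h 0" using eq0 by simp
    moreover have "y i * u 0 \<in> homog n (j + 1)" using u0 by (intro homog_mult'[OF lin_homog]) auto
    ultimately have "p 0 \<in> homog n (j + 1)" using form_combs_homog[OF h0] by (metis homog_diff)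
    then have "p 0 \<in> vanish n (\<Union>a\<in>A. V a) (j + 1)"
      using p vanishing_ideal_homog[OF A(3), of n V "j + 1"] by (auto simp: coord_module_def)
    then have "y i * u 0 \<in> IY A i (j + 1)" unfolding eq0 using h0 by (rule ideal_plusI)
    then have "u 0 \<in> IY A i j" using j by - (rule colon_ideal[OF A(2,1) i _ u0], auto)
    then obtain p' h' where ph': "p' \<in> vanish n (\<Union>a\<in>A. V a) j" "h' \<in> form_combs n c i j" "u 0 = p' + h'"
      unfolding ideal_plus_def by blast
    have "p' \<in> ?I" using ph'(1) vanishing_ideal_homog[OF A(3), of n V j] by blast
    moreover have "embed h' \<in> vcombs n c (FG n 1 (\<lambda>_. 0)) i j"
      unfolding vcombs_FG_coord FG_rank_one using ph'(2) form_combs_homog[OF ph'(2)] by (simp add: embed_def)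
    moreover have "u = embed p' + embed h'"
      using u ph'(3) unfolding FG_rank_one by (auto simp: fun_eq_iff embed_def)
    ultimately show "\<exists>p'\<in>coord_module ?I. \<exists>h'\<in>vcombs n c (FG n 1 (\<lambda>_. 0)) i j. u = p' + h'"
      using embed_coord_module by blast
  qed (use card in auto)
qed

lemma free_module_simps [simp]:
  "u \<oplus>\<^bsub>free_module n b\<^esub> v = u + v" "p \<odot>\<^bsub>free_module n b\<^esub> v = sm p v" "\<zero>\<^bsub>free_module n b\<^esub> = 0"
  by (simp_all add: free_module_def plus_fun_def zero_fun_def sm_def)

text \<open>Iterating \<open>stage_step\<close> from F = S resolves S/I. Leaving out S gives a
  resolution of I with the free module of stage \<open>i + 1\<close> in position \<open>i\<close>,
  which turns the bound \<open>r\<close> into \<open>r + 1\<close>.\<close>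

lemma (in linear_forms_seq) resolution:
  assumes I: "homog_ideal n I" and st: "stage r 1 (\<lambda>_. 0) (coord_module I)"
  shows "\<exists>b e \<epsilon> d. minimal_graded_free_resolution n (ideal_module n I) (\<lambda>j. I \<inter> homog n j) b e \<epsilon> d \<and>
    (\<forall>i. \<forall>\<alpha><b i. e i \<alpha> \<le> r + 1 + int i)"
proof -
  \<comment> \<open>The last clause pins the start of the chain, since the choice principle only
    returns some element satisfying \<open>P 0\<close>.\<close>
  define P where "P = (\<lambda>m x. stage (r + int m) (fst x) (fst (snd x)) (snd (snd x)) \<and>
    (m = 0 \<longrightarrow> x = (1, (\<lambda>_. 0), coord_module I)))"
  define R where "R = (\<lambda>(x :: nat \<times> (nat \<Rightarrow> int) \<times> (nat \<Rightarrow> 'k mpoly) set) (y :: nat \<times> (nat \<Rightarrow> int) \<times> (nat \<Rightarrow> 'k mpoly) set) \<phi>.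
    graded_hom n (free_module n (fst y)) (FG n (fst y) (fst (snd y))) (free_module n (fst x)) (FG n (fst x) (fst (snd x))) \<phi> \<and>
    \<phi> ` FM n (fst y) = snd (snd x) \<and> snd (snd y) = {v \<in> FM n (fst y). \<phi> v = 0} \<and>
    (\<forall>v\<in>snd (snd y). \<forall>\<beta><fst y. v \<beta> \<in> irrelevant_ideal n))"
  have "\<exists>f. \<forall>m. P m (f m) \<and> (\<exists>\<phi>. R (f m) (f (Suc m)) \<phi>)"
  proof (rule dependent_nat_choice)
    show "\<exists>x. P 0 x" using st by (auto simp: P_def)
    fix x m assume "P m x"
    then have "stage (r + int m) (fst x) (fst (snd x)) (snd (snd x))" by (simp add: P_def)
    from stage_step[OF this] obtain b' e' N' \<phi> where *: "stage (r + int m + 1) b' e' N'"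
      "graded_hom n (free_module n b') (FG n b' e') (free_module n (fst x)) (FG n (fst x) (fst (snd x))) \<phi>"
      "\<phi> ` FM n b' = snd (snd x)" "N' = {v \<in> FM n b'. \<phi> v = 0}"
      "\<forall>v\<in>N'. \<forall>\<beta><b'. v \<beta> \<in> irrelevant_ideal n"
      by blast
    have "r + int m + 1 = r + int (Suc m)" by simp
    then have "P (Suc m) (b', e', N')" using *(1) by (simp only: P_def fst_conv snd_conv nat.distinct simp_thms)
    moreover have "R x (b', e', N') \<phi>" using *(2-5) by (simp add: R_def)
    ultimately show "\<exists>y. P (Suc m) y \<and> (\<exists>\<phi>. R x y \<phi>)" by blast
  qed
  then obtain f where f: "\<And>m. P m (f m)" "\<forall>m. \<exists>\<phi>. R (f m) (f (Suc m)) \<phi>" by blast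
  obtain \<phi> where \<phi>: "\<And>m. R (f m) (f (Suc m)) (\<phi> m)" using choice[OF f(2)] by blast
  define b where "b = (\<lambda>m. fst (f m))"
  define e where "e = (\<lambda>m. fst (snd (f m)))"
  define N where "N = (\<lambda>m. snd (snd (f m)))"
  have hom: "graded_hom n (free_module n (b (Suc m))) (FG n (b (Suc m)) (e (Suc m))) (free_module n (b m)) (FG n (b m) (e m)) (\<phi> m)"
    and im: "\<phi> m ` FM n (b (Suc m)) = N m" and ker: "N (Suc m) = {v \<in> FM n (b (Suc m)). \<phi> m v = 0}"
    and irr: "\<And>v \<beta>. v \<in> N (Suc m) \<Longrightarrow> \<beta> < b (Suc m) \<Longrightarrow> v \<beta> \<in> irrelevant_ideal n" for m
    using \<phi>[of m] unfolding R_def b_def e_def N_def by blast+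
  have zero: "b 0 = 1" "e 0 = (\<lambda>_. 0)" "N 0 = coord_module I"
    using f(1)[of 0] by (simp_all add: P_def b_def e_def N_def)
  have twists: "e (Suc i) \<alpha> \<le> r + 1 + int i" if "\<alpha> < b (Suc i)" for i \<alpha>
    using f(1)[of "Suc i"] that unfolding P_def stage_def b_def e_def by (auto simp: algebra_simps)
  \<comment> \<open>The augmentation is \<open>\<phi> 0\<close> followed by the identification of
    \<open>coord_module I\<close> with I, that is, reading off coordinate 0.\<close>
  define \<epsilon> where "\<epsilon> = (\<lambda>v. \<phi> 0 v 0)"
  have \<phi>0: "\<phi> 0 v \<in> coord_module I" if "v \<in> FM n (b 1)" for v
    using im[of 0] that zero by auto
  have \<epsilon>0: "\<epsilon> v = 0 \<longleftrightarrow> \<phi> 0 v = 0" if "v \<in> FM n (b 1)" for v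
  proof
    assume "\<epsilon> v = 0"
    then have "\<phi> 0 v \<alpha> = 0" for \<alpha> using \<phi>0[OF that] by (cases "\<alpha> = 0") (auto simp: \<epsilon>_def coord_module_def)
    then show "\<phi> 0 v = 0" by (simp add: fun_eq_iff)
  qed (simp add: \<epsilon>_def)
  have "minimal_graded_free_resolution n (ideal_module n I) (\<lambda>j. I \<inter> homog n j)
      (\<lambda>i. b (Suc i)) (\<lambda>i. e (Suc i)) \<epsilon> (\<lambda>i. \<phi> (Suc i))"
    unfolding minimal_graded_free_resolution_def Let_def
  proof (intro conjI allI ballI impI)
    show "graded_hom n (free_module n (b (Suc 0))) (FG n (b (Suc 0)) (e (Suc 0))) (ideal_module n I) (\<lambda>j. I \<inter> homog n j) \<epsilon>"
      unfolding graded_hom_def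
    proof (intro conjI ballI allI)
      show "\<epsilon> \<in> FM n (b (Suc 0)) \<rightarrow> carrier (ideal_module n I)"
        using \<phi>0 by (auto simp: \<epsilon>_def ideal_module_def coord_module_def)
      fix x :: "nat \<Rightarrow> 'k mpoly" assume x: "x \<in> FM n (b (Suc 0))"
      show "\<epsilon> (x \<oplus>\<^bsub>free_module n (b (Suc 0))\<^esub> z) = \<epsilon> x \<oplus>\<^bsub>ideal_module n I\<^esub> \<epsilon> z" if "z \<in> FM n (b (Suc 0))" for z
        using hom[of 0] x that unfolding graded_hom_def by (simp add: \<epsilon>_def ideal_module_def)
    next
      fix a :: "'k mpoly" and x :: "nat \<Rightarrow> 'k mpoly" assume "a \<in> carrier (polyring n)" "x \<in> FM n (b (Suc 0))"
      then show "\<epsilon> (a \<odot>\<^bsub>free_module n (b (Suc 0))\<^esub> x) = a \<odot>\<^bsub>ideal_module n I\<^esub> \<epsilon> x"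
        using hom[of 0] unfolding graded_hom_def by (simp add: \<epsilon>_def ideal_module_def)
    next
      fix j
      show "\<epsilon> ` FG n (b (Suc 0)) (e (Suc 0)) j \<subseteq> I \<inter> homog n j"
      proof (rule image_subsetI)
        fix v :: "nat \<Rightarrow> 'k mpoly" assume v: "v \<in> FG n (b (Suc 0)) (e (Suc 0)) j"
        then have "\<phi> 0 v \<in> FG n 1 (\<lambda>_. 0) j" using hom[of 0] unfolding graded_hom_def zero by blast
        then have "\<phi> 0 v 0 \<in> homog n j" unfolding FG_rank_one by simp
        then show "\<epsilon> v \<in> I \<inter> homog n j"
          using \<phi>0[of v] FG_FM[OF v] by (simp add: \<epsilon>_def coord_module_def)
      qed
    qed
    show "\<epsilon> ` FM n (b (Suc 0)) = carrier (ideal_module n I)"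
    proof -
      have "\<epsilon> ` FM n (b (Suc 0)) = (\<lambda>v. v 0) ` coord_module I"
        unfolding zero(3)[symmetric] im[of 0, symmetric] image_image \<epsilon>_def ..
      also have "\<dots> = I"
      proof
        show "I \<subseteq> (\<lambda>v. v 0) ` coord_module I"
        proof
          fix p assume "p \<in> I"
          then have "embed p 0 \<in> (\<lambda>v. v 0) ` coord_module I"
            by (intro imageI embed_coord_module)
          then show "p \<in> (\<lambda>v. v 0) ` coord_module I" by (simp add: embed_def)
        qed
      qed (auto simp: coord_module_def)
      finally show ?thesis by (simp add: ideal_module_def)
    qed
    have "\<phi> (Suc 0) ` FM n (b (Suc (Suc 0))) = {v \<in> FM n (b (Suc 0)). \<phi> 0 v = 0}"
      unfolding im ker ..
    also have "\<dots> = {v \<in> FM n (b (Suc 0)). \<epsilon> v = 0}" using \<epsilon>0 by auto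
    finally show "\<phi> (Suc 0) ` FM n (b (Suc 1)) = {v \<in> FM n (b (Suc 0)). \<epsilon> v = \<zero>\<^bsub>ideal_module n I\<^esub>}"
      by (simp add: ideal_module_def)
    show "\<phi> (Suc (Suc i)) ` FM n (b (Suc (Suc (Suc i)))) =
        {v \<in> FM n (b (Suc (Suc i))). \<phi> (Suc i) v = \<zero>\<^bsub>free_module n (b (Suc i))\<^esub>}" for i
      unfolding im ker free_module_simps ..
    show "graded_hom n (free_module n (b (Suc (Suc i)))) (FG n (b (Suc (Suc i))) (e (Suc (Suc i))))
        (free_module n (b (Suc i))) (FG n (b (Suc i)) (e (Suc i))) (\<phi> (Suc i))" for i
      by (rule hom)
    fix i \<alpha> and v :: "nat \<Rightarrow> 'k mpoly" assume "v \<in> FM n (b (Suc (Suc i)))" and \<alpha>: "\<alpha> < b (Suc i)"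
    then have "\<phi> (Suc i) v \<in> N (Suc i)" using im[of "Suc i"] by blast
    then show "\<phi> (Suc i) v \<alpha> \<in> irrelevant_ideal n" using \<alpha> by (rule irr)
  qed
  then show ?thesis using twists by blast
qed

theorem theorem2p1:
  fixes n d :: nat and L :: "nat \<Rightarrow> (nat \<Rightarrow> 'k::field) set"
  assumes "infinite (UNIV :: 'k set)"
    and "d \<ge> 1"
    and "\<And>i. i \<in> {1..d} \<Longrightarrow> linear_space n (L i)"
  shows "regular_ideal n (int d) (\<Inter>i\<in>{1..d}. vanishing_ideal n (L i))"
proof -
  let ?I = "\<Inter>i\<in>{1..d}. vanishing_ideal n (L i)"
  have ne: "{1..d} \<noteq> {}" using assms(2) by simp
  have I: "homog_ideal n ?I"
    using homog_ideal_arrangement[OF assms(1,3) ne] .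
  \<comment> \<open>Index 0 is free, as the spaces are numbered from 1. With the whole space placed
    there, one sequence of forms serves both S and the arrangement.\<close>
  define V where "V = L(0 := coord_space n)"
  have "linear_space n (V a)" if "a \<in> {0..d}" for a
    using assms(3)[of a] that linear_space_coord_space by (auto simp: V_def)
  then obtain c where "generic_forms n {0..d} V c"
    using exists_generic_forms[OF assms(1), of "{0..d}" n V] by auto
  then interpret G: generic_forms n "{0..d}" V c .
  interpret linear_forms_seq n c
    by (rule G.linear_forms_seq[of 0]) (auto simp: V_def)
  have "(\<Inter>a\<in>{1..d}. vanishing_ideal n (V a)) = ?I" by (auto simp: V_def)
  then have "stage (int d - 1) 1 (\<lambda>_. 0) (coord_module ?I)"
    using G.stage_arrangement[of 0 "{1..d}"] ne by (simp add: V_def)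
  from resolution[OF I this] have "regular_module n (int d) (ideal_module n ?I) (\<lambda>j. ?I \<inter> homog n j)"
    unfolding regular_module_def using graded_module_ideal[OF I] by simp
  then show ?thesis
    unfolding regular_ideal_def using ideal_polyring[OF I] by blast
qed

end
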